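(* Let $p$ be a prime, let $q$ and $n$ be positive integers, let $T(p,q)$ be the torus link and $R_n$ the dihedral quandle of order $n$. If $|\operatorname{Hom}(Q(T(p,q)),R_n)|=pn$, then the full quandle coloring quiver of $T(p,q)$ with respect to $R_n$ is (isomorphic to) the directed graph $$\mathcal{Q}_{R_n}(T(p,q))=(\overleftrightarrow{K_n},\hat n)\,\overleftarrow{\nabla}_{\hat d}\,\left(\overleftrightarrow{K_{(p-1)n}},\hat d\right),\qquad d=\frac{n}{p}.$$
   Context: A quandle is a set $X$ with a binary operation $*$ such that $(x*y)*z=(x*z)*(y*z)$ for all $x,y,z$; for each $x$ the map $R_x:X\to X$, $y\mapsto y*x$, is a bijection; and $x*x=x$ for all $x$. Write $x\bar{*}y=R_y^{-1}(x)$. The dihedral quandle $R_n$ is $\mathbb{Z}_n=\mathbb{Z}/n\mathbb{Z}$ with $x*y=2y-x \pmod n$. A quandle homomorphism is a map preserving $*$. For an oriented link $K$ with diagram $D$, the fundamental quandle $Q(K)$ is the quandle generated by the arcs of $D$ with one relation per crossing: if $y$ is the over-arc and $x,z$ are the incoming and outgoing under-arcs, then $z=x*y$ at a positive crossing and $z=x\bar{*}y$ at a negative crossing. $\operatorname{Hom}(Q(K),X)$ is the set of quandle homomorphisms $Q(K)\to X$; it is identified with the set of colorings of $D$ by $X$, i.e. maps from arcs to $X$ satisfying the crossing relations. The torus link $T(p,q)$ is the closure of the $p$-strand braid $(\sigma_1\sigma_2\cdots\sigma_{p-1})^q$. The full quandle coloring quiver $\mathcal{Q}_X(K)$ of $K$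 with respect to a finite quandle $X$ is the directed multigraph with vertex set $\operatorname{Hom}(Q(K),X)$ and, for each vertex $f$ and each quandle endomorphism $\phi:X\to X$, one directed edge from $f$ to $\phi\circ f$. Notation: $(\overleftrightarrow{K_m},\hat\omega)$ is the directed multigraph on $m$ vertices with exactly $\omega$ directed edges from each vertex to each vertex (including from each vertex to itself). For directed multigraphs $G_1,G_2$ with disjoint vertex and edge sets, $G_1\overleftarrow{\nabla}_{\hat d}G_2$ is the union of $G_1$ and $G_2$ together with exactly $d$ directed edges from each vertex of $G_2$ to each vertex of $G_1$ (and no edges from $G_1$ to $G_2$). Equality of directed multigraphs means isomorphism. *)

theory Defs
  imports
    Complex_Main
    "HOL-Library.FuncSet"
    "HOL-Computational_Algebra.Primes"
    "Graph_Theory.Digraph_Isomorphism"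
begin

section \<open>Quandles\<close>

record 'a quandle_structure =
  qcarrier :: "'a set"
  qop :: "'a \<Rightarrow> 'a \<Rightarrow> 'a"

definition quandle :: "'a quandle_structure \<Rightarrow> bool" where
  "quandle X \<longleftrightarrow>
     (\<forall>x\<in>qcarrier X. \<forall>y\<in>qcarrier X. \<forall>z\<in>qcarrier X.
        qop X (qop X x y) z = qop X (qop X x z) (qop X y z)) \<and>
     (\<forall>x\<in>qcarrier X. bij_betw (\<lambda>y. qop X y x) (qcarrier X) (qcarrier X)) \<and>
     (\<forall>x\<in>qcarrier X. qop X x x = x)"

definition qbar :: "'a quandle_structure \<Rightarrow> 'a \<Rightarrow> 'a \<Rightarrow> 'a" where
  "qbar X x y = the_inv_into (qcarrier X) (\<lambda>u. qop X u y) x"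

text \<open>Homomorphisms are extensional functions (\<open>undefined\<close> outside the carrier), so that
  distinct elements of \<open>quandle_hom X Y\<close> are distinct maps on the carrier of \<open>X\<close>.\<close>

definition quandle_hom :: "'a quandle_structure \<Rightarrow> 'b quandle_structure \<Rightarrow> ('a \<Rightarrow> 'b) set" where
  "quandle_hom X Y = {f \<in> qcarrier X \<rightarrow>\<^sub>E qcarrier Y.
     \<forall>x\<in>qcarrier X. \<forall>y\<in>qcarrier X. f (qop X x y) = qop Y (f x) (f y)}"

definition dihedral_quandle :: "nat \<Rightarrow> int quandle_structure" where
  "dihedral_quandle n = \<lparr>qcarrier = {0..<int n}, qop = (\<lambda>x y. (2 * y - x) mod int n)\<rparr>"

lemma quandle_dihedral:
  assumes "n > 0"
  shows "quandle (dihedral_quandle n)"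
proof -
  have bij: "bij_betw (\<lambda>y. (2 * x - y) mod int n) {0..<int n} {0..<int n}" for x
    by (rule bij_betw_byWitness[where f' = "\<lambda>y. (2 * x - y) mod int n"])
      (use assms in \<open>auto simp: mod_diff_right_eq\<close>)
  have dist: "(2 * z - (2 * y - x) mod int n) mod int n =
      (2 * ((2 * z - y) mod int n) - (2 * z - x) mod int n) mod int n" for x y z
  proof -
    have "(2 * ((2 * z - y) mod int n) - (2 * z - x) mod int n) mod int n
        = ((2 * ((2 * z - y) mod int n)) mod int n - (2 * z - x) mod int n) mod int n"
      by (rule mod_diff_left_eq[symmetric])
    also have "\<dots> = (2 * (2 * z - y) - (2 * z - x)) mod int n"
      by (simp only: mod_mult_right_eq mod_diff_eq)
    also have "2 * (2 * z - y) - (2 * z - x) = 2 * z - (2 * y - x)" by simp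
    finally show ?thesis by (simp only: mod_diff_right_eq)
  qed
  show ?thesis
    unfolding quandle_def dihedral_quandle_def quandle_structure.select_convs
    using bij dist by auto
qed


section \<open>Quandles given by generators and relations\<close>

datatype 'a qterm = Gen 'a | Op "'a qterm" "'a qterm" | OpBar "'a qterm" "'a qterm"

definition qterms :: "'a set \<Rightarrow> 'a qterm set" where
  "qterms S = {t. set_qterm t \<subseteq> S}"

text \<open>The least congruence on the terms over \<open>S\<close> that contains the relations \<open>R\<close> and the
  quandle axioms; bijectivity of right translation is expressed by letting \<open>OpBar\<close> be inverse
  to \<open>Op\<close>.\<close>

inductive_set qcong :: "'a set \<Rightarrow> ('a qterm \<times> 'a qterm) set \<Rightarrow> ('a qterm \<times> 'a qterm) set"
  for S R where
  rel: "(s, t) \<in> R \<Longrightarrow> s \<in> qterms S \<Longrightarrow> t \<in> qterms S \<Longrightarrow> (s, t) \<in> qcong S R"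
| refl: "s \<in> qterms S \<Longrightarrow> (s, s) \<in> qcong S R"
| sym: "(s, t) \<in> qcong S R \<Longrightarrow> (t, s) \<in> qcong S R"
| trans: "(s, t) \<in> qcong S R \<Longrightarrow> (t, u) \<in> qcong S R \<Longrightarrow> (s, u) \<in> qcong S R"
| op_cong: "(s, s') \<in> qcong S R \<Longrightarrow> (t, t') \<in> qcong S R \<Longrightarrow> (Op s t, Op s' t') \<in> qcong S R"
| bar_cong: "(s, s') \<in> qcong S R \<Longrightarrow> (t, t') \<in> qcong S R \<Longrightarrow> (OpBar s t, OpBar s' t') \<in> qcong S R"
| idem: "s \<in> qterms S \<Longrightarrow> (Op s s, s) \<in> qcong S R"
| op_bar: "s \<in> qterms S \<Longrightarrow> t \<in> qterms S \<Longrightarrow> (OpBar (Op s t) t, s) \<in> qcong S R"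
| bar_op: "s \<in> qterms S \<Longrightarrow> t \<in> qterms S \<Longrightarrow> (Op (OpBar s t) t, s) \<in> qcong S R"
| distrib: "s \<in> qterms S \<Longrightarrow> t \<in> qterms S \<Longrightarrow> u \<in> qterms S \<Longrightarrow>
    (Op (Op s t) u, Op (Op s u) (Op t u)) \<in> qcong S R"

definition presented_quandle ::
  "'a set \<Rightarrow> ('a qterm \<times> 'a qterm) set \<Rightarrow> 'a qterm set quandle_structure" where
  "presented_quandle S R = \<lparr>qcarrier = qterms S // qcong S R,
     qop = (\<lambda>A B. \<Union>s\<in>A. \<Union>t\<in>B. qcong S R `` {Op s t})\<rparr>"

lemma qterms_simps [simp]:
  "Gen a \<in> qterms S \<longleftrightarrow> a \<in> S"
  "Op s t \<in> qterms S \<longleftrightarrow> s \<in> qterms S \<and> t \<in> qterms S"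
  "OpBar s t \<in> qterms S \<longleftrightarrow> s \<in> qterms S \<and> t \<in> qterms S"
  by (auto simp: qterms_def)

lemma qcong_qterms: "(s, t) \<in> qcong S R \<Longrightarrow> s \<in> qterms S \<and> t \<in> qterms S"
  by (induction rule: qcong.induct) auto

lemma equiv_qcong: "equiv (qterms S) (qcong S R)"
proof (rule equivI)
  show "qcong S R \<subseteq> qterms S \<times> qterms S" using qcong_qterms by fastforce
  show "refl_on (qterms S) (qcong S R)" by (auto intro: refl_onI qcong.refl)
  show "sym (qcong S R)" by (auto intro: symI qcong.sym)
  show "trans (qcong S R)" by (blast intro: transI qcong.trans)
qed

lemma qop_presented_quandle:
  assumes "s \<in> qterms S" "t \<in> qterms S"
  shows "qop (presented_quandle S R) (qcong S R `` {s}) (qcong S R `` {t}) = qcong S R `` {Op s t}"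
proof -
  have "congruent2 (qcong S R) (qcong S R) (\<lambda>s t. qcong S R `` {Op s t})"
  proof (rule congruent2I')
    fix s s' t t' assume "(s, s') \<in> qcong S R" "(t, t') \<in> qcong S R"
    then have "(Op s t, Op s' t') \<in> qcong S R" by (rule qcong.op_cong)
    then show "qcong S R `` {Op s t} = qcong S R `` {Op s' t'}"
      by (rule equiv_class_eq[OF equiv_qcong])
  qed
  from UN_equiv_class2[OF equiv_qcong equiv_qcong this] show ?thesis
    using assms by (simp add: presented_quandle_def)
qed

lemma qcarrier_presented_quandleE:
  assumes "A \<in> qcarrier (presented_quandle S R)"
  obtains s where "s \<in> qterms S" "A = qcong S R `` {s}"
  using assms by (auto simp: presented_quandle_def elim: quotientE)

lemma qclass_in_presented_quandle:
  "s \<in> qterms S \<Longrightarrow> qcong S R `` {s} \<in> qcarrier (presented_quandle S R)"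
  by (auto simp: presented_quandle_def intro: quotientI)

lemma qclass_eq: "(s, t) \<in> qcong S R \<Longrightarrow> qcong S R `` {s} = qcong S R `` {t}"
  by (rule equiv_class_eq[OF equiv_qcong])

lemma bij_betw_presented_quandle:
  assumes t: "t \<in> qterms S"
  shows "bij_betw (\<lambda>A. qop (presented_quandle S R) A (qcong S R `` {t}))
     (qcarrier (presented_quandle S R)) (qcarrier (presented_quandle S R))"
proof -
  let ?Q = "presented_quandle S R" and ?c = "\<lambda>s. qcong S R `` {s}"
  let ?f = "\<lambda>A. qop ?Q A (?c t)"
  have "inj_on ?f (qcarrier ?Q)"
  proof (rule inj_onI)
    fix A B assume "A \<in> qcarrier ?Q" "B \<in> qcarrier ?Q" and eq: "?f A = ?f B"
    then obtain s u where s: "s \<in> qterms S" "A = ?c s" and u: "u \<in> qterms S" "B = ?c u"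
      by (metis qcarrier_presented_quandleE)
    from eq s u t have "(Op s t, Op u t) \<in> qcong S R"
      by (simp add: qop_presented_quandle eq_equiv_class_iff[OF equiv_qcong])
    from qcong.bar_cong[OF this qcong.refl[OF t]]
    have "(s, u) \<in> qcong S R"
      using qcong.op_bar[OF s(1) t] qcong.op_bar[OF u(1) t] by (blast intro: qcong.sym qcong.trans)
    then show "A = B" using s u by (simp add: qclass_eq)
  qed
  moreover have "?f A \<in> qcarrier ?Q" if "A \<in> qcarrier ?Q" for A
    using that t by (elim qcarrier_presented_quandleE)
      (simp add: qop_presented_quandle qclass_in_presented_quandle)
  moreover have "\<exists>B\<in>qcarrier ?Q. ?f B = A" if A: "A \<in> qcarrier ?Q" for A
  proof -
    obtain s where s: "s \<in> qterms S" "A = ?c s" using A by (rule qcarrier_presented_quandleE)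
    then have "?f (?c (OpBar s t)) = A"
      using t qclass_eq[OF qcong.bar_op[OF s(1) t]] by (simp add: qop_presented_quandle)
    then show ?thesis using s t qclass_in_presented_quandle[of "OpBar s t"] by auto
  qed
  ultimately show ?thesis
    by (intro bij_betw_imageI equalityI subsetI) (blast, blast, metis imageI)
qed

lemma quandle_presented_quandle: "quandle (presented_quandle S R)"
  unfolding quandle_def
proof (intro conjI ballI)
  let ?Q = "presented_quandle S R"
  fix A assume "A \<in> qcarrier ?Q"
  then obtain s where s: "s \<in> qterms S" "A = qcong S R `` {s}"
    by (rule qcarrier_presented_quandleE)
  show "bij_betw (\<lambda>B. qop ?Q B A) (qcarrier ?Q) (qcarrier ?Q)"
    unfolding s(2) by (rule bij_betw_presented_quandle[OF s(1)])
  show "qop ?Q A A = A"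
    unfolding s(2) qop_presented_quandle[OF s(1) s(1)] by (rule qclass_eq[OF qcong.idem[OF s(1)]])
  fix B C assume "B \<in> qcarrier ?Q" "C \<in> qcarrier ?Q"
  then obtain t u where t: "t \<in> qterms S" "B = qcong S R `` {t}"
      and u: "u \<in> qterms S" "C = qcong S R `` {u}"
    by (metis qcarrier_presented_quandleE)
  show "qop ?Q (qop ?Q A B) C = qop ?Q (qop ?Q A C) (qop ?Q B C)"
    using s t u qclass_eq[OF qcong.distrib[OF s(1) t(1) u(1)]]
    by (simp add: qop_presented_quandle)
qed

lemma qbar_presented_quandle:
  assumes s: "s \<in> qterms S" and t: "t \<in> qterms S"
  shows "qbar (presented_quandle S R) (qcong S R `` {s}) (qcong S R `` {t})
    = qcong S R `` {OpBar s t}"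
  unfolding qbar_def
proof (rule the_inv_into_f_eq)
  show "inj_on (\<lambda>A. qop (presented_quandle S R) A (qcong S R `` {t}))
      (qcarrier (presented_quandle S R))"
    by (rule bij_betw_imp_inj_on[OF bij_betw_presented_quandle[OF t]])
  show "qop (presented_quandle S R) (qcong S R `` {OpBar s t}) (qcong S R `` {t})
      = qcong S R `` {s}"
    using s t qclass_eq[OF qcong.bar_op[OF s t]] by (simp add: qop_presented_quandle)
  show "qcong S R `` {OpBar s t} \<in> qcarrier (presented_quandle S R)"
    using s t by (simp add: qclass_in_presented_quandle)
qed


section \<open>Oriented link diagrams and the fundamental quandle\<close>

datatype crossing_sign = Positive | Negative

text \<open>A diagram is recorded by its arcs and, for each crossing, the tuple
  (sign, over-arc, incoming under-arc, outgoing under-arc).\<close>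

record 'a link_diagram =
  diagram_arcs :: "'a set"
  diagram_crossings :: "(crossing_sign \<times> 'a \<times> 'a \<times> 'a) set"

fun crossing_relation :: "crossing_sign \<times> 'a \<times> 'a \<times> 'a \<Rightarrow> 'a qterm \<times> 'a qterm" where
  "crossing_relation (Positive, y, x, z) = (Gen z, Op (Gen x) (Gen y))"
| "crossing_relation (Negative, y, x, z) = (Gen z, OpBar (Gen x) (Gen y))"

definition fundamental_quandle :: "'a link_diagram \<Rightarrow> 'a qterm set quandle_structure" where
  "fundamental_quandle D =
     presented_quandle (diagram_arcs D) (crossing_relation ` diagram_crossings D)"


section \<open>Closed braids and torus links\<close>

text \<open>Braids are drawn with all strands oriented upwards, positions numbered \<open>1, \<dots>, p\<close> from left
  to right and the first letter of the word at the bottom. The letter \<open>(Positive, i)\<close> is the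
  generator \<open>\<sigma>\<^sub>i\<close>: the strand at position \<open>i\<close> moves to position \<open>i + 1\<close>, passing over the strand
  moving from \<open>i + 1\<close> to \<open>i\<close>, which makes a positive crossing. The letter \<open>(Negative, i)\<close> is its
  inverse: the strand moving from \<open>i + 1\<close> to \<open>i\<close> passes over.\<close>

type_synonym braid_word = "(crossing_sign \<times> nat) list"

text \<open>Positions at which the over-strand and the under-strand enter the crossing. Each strand
  leaves the crossing at the position where the other one enters.\<close>

fun over_pos :: "crossing_sign \<times> nat \<Rightarrow> nat" where
  "over_pos (Positive, i) = i"
| "over_pos (Negative, i) = Suc i"

fun under_pos :: "crossing_sign \<times> nat \<Rightarrow> nat" where
  "under_pos (Positive, i) = Suc i"
| "under_pos (Negative, i) = i"

text \<open>The pair \<open>(j, t)\<close> stands for the point at position \<open>j\<close> after the first \<open>t\<close> letters. The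
  relation below joins consecutive points between which the link does not pass under a crossing;
  its last part closes the braid. An arc of the diagram of the closed braid is a class of points
  under the equivalence relation generated by it.\<close>

definition braid_points :: "nat \<Rightarrow> braid_word \<Rightarrow> (nat \<times> nat) set" where
  "braid_points p w = {1..p} \<times> {0..length w}"

definition arc_step :: "nat \<Rightarrow> braid_word \<Rightarrow> ((nat \<times> nat) \<times> (nat \<times> nat)) set" where
  "arc_step p w =
     {((over_pos (w ! t), t), (under_pos (w ! t), Suc t)) | t. t < length w} \<union>
     {((j, t), (j, Suc t)) | j t. j \<in> {1..p} \<and> t < length w \<and>
        j \<noteq> over_pos (w ! t) \<and> j \<noteq> under_pos (w ! t)} \<union>
     {((j, length w), (j, 0)) | j. j \<in> {1..p}}"

definition arc_of :: "nat \<Rightarrow> braid_word \<Rightarrow> nat \<times> nat \<Rightarrow> (nat \<times> nat) set" where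
  "arc_of p w x = (arc_step p w \<union> (arc_step p w)\<inverse>)\<^sup>* `` {x}"

definition braid_closure :: "nat \<Rightarrow> braid_word \<Rightarrow> (nat \<times> nat) set link_diagram" where
  "braid_closure p w = \<lparr>diagram_arcs = arc_of p w ` braid_points p w,
     diagram_crossings =
       {(fst (w ! t), arc_of p w (over_pos (w ! t), t), arc_of p w (under_pos (w ! t), t),
          arc_of p w (over_pos (w ! t), Suc t)) | t. t < length w}\<rparr>"

definition torus_braid :: "nat \<Rightarrow> nat \<Rightarrow> braid_word" where
  "torus_braid p q = concat (replicate q (map (Pair Positive) [1..<p]))"

definition torus_link :: "nat \<Rightarrow> nat \<Rightarrow> (nat \<times> nat) set link_diagram" where
  "torus_link p q = braid_closure p (torus_braid p q)"


section \<open>Directed multigraphs and the full quandle coloring quiver\<close>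

definition full_quandle_coloring_quiver ::
  "'a link_diagram \<Rightarrow> 'b quandle_structure \<Rightarrow>
     ('a qterm set \<Rightarrow> 'b, ('a qterm set \<Rightarrow> 'b) \<times> ('b \<Rightarrow> 'b)) pre_digraph" where
  "full_quandle_coloring_quiver D X =
     \<lparr>verts = quandle_hom (fundamental_quandle D) X,
      arcs = quandle_hom (fundamental_quandle D) X \<times> quandle_hom X X,
      tail = fst,
      head = (\<lambda>(f, \<phi>). compose (qcarrier (fundamental_quandle D)) \<phi> f)\<rparr>"

definition complete_multidigraph :: "nat \<Rightarrow> nat \<Rightarrow> (nat, nat \<times> nat \<times> nat) pre_digraph" where
  "complete_multidigraph m \<omega> =
     \<lparr>verts = {..<m}, arcs = {..<m} \<times> {..<m} \<times> {..<\<omega>},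
      tail = (\<lambda>(u, v, k). u), head = (\<lambda>(u, v, k). v)\<rparr>"

text \<open>\<open>digraph_join d G1 G2\<close>: the sum types make the two graphs disjoint, and the edges
  \<open>Inr (v, u, k)\<close> with \<open>k < d\<close> are the \<open>d\<close> additional edges from the vertex \<open>v\<close> of \<open>G2\<close> to the
  vertex \<open>u\<close> of \<open>G1\<close>.\<close>

definition digraph_join :: "nat \<Rightarrow> ('a, 'e) pre_digraph \<Rightarrow> ('b, 'f) pre_digraph \<Rightarrow>
    ('a + 'b, ('e + 'f) + ('b \<times> 'a \<times> nat)) pre_digraph" where
  "digraph_join d G1 G2 =
     \<lparr>verts = verts G1 <+> verts G2,
      arcs = (arcs G1 <+> arcs G2) <+> (verts G2 \<times> verts G1 \<times> {..<d}),
      tail = case_sum (case_sum (\<lambda>e. Inl (tail G1 e)) (\<lambda>e. Inr (tail G2 e)))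
               (\<lambda>(v, u, k). Inr v),
      head = case_sum (case_sum (\<lambda>e. Inl (head G1 e)) (\<lambda>e. Inr (head G2 e)))
               (\<lambda>(v, u, k). Inl u)\<rparr>"

end

theory Submission
  imports Defs
begin

text \<open>
  A coloring of \<open>T(p,q)\<close> is a tuple \<open>x\<close> fixed by the \<open>q\<close>-th power of
  \<open>T x = (2x\<^sub>1 - x\<^sub>2, \<dots>, 2x\<^sub>1 - x\<^sub>p, x\<^sub>1)\<close>, the action of \<open>\<sigma>\<^sub>1 \<dots> \<sigma>\<^bsub>p-1\<^esub>\<close>. On the cyclic
  differences of \<open>x\<close>, which determine \<open>x\<close> up to translation, \<open>-T\<close> acts as the cyclic shift. Hence
  \<open>pn\<close> colorings have exactly \<open>p\<close> difference sequences, and these are permuted by the shift. As \<open>p\<close>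
  is prime, a nonconstant sequence would have \<open>p\<close> distinct shifts, too many next to the zero
  sequence. So all differences are constant, \<open>p\<close> divides \<open>n\<close>, and the colorings are
  \<open>x\<^sub>j = b + (j - 1) k n/p\<close> with \<open>b\<close> modulo \<open>n\<close> and \<open>k\<close> modulo \<open>p\<close>. The endomorphism \<open>y \<mapsto> e + c y\<close>
  of \<open>R\<^sub>n\<close> takes the parameters \<open>(b, k)\<close> to \<open>(e + c b, c k)\<close>, so edge multiplicities count the \<open>c\<close>
  with \<open>c k = k'\<close> modulo \<open>p\<close>; the vertices with \<open>k = 0\<close> form the first summand of the join.
\<close>

section \<open>Colorings as quandle homomorphisms\<close>

lemma quandle_bij_betw:
  assumes "quandle X" "y \<in> qcarrier X"
  shows "bij_betw (\<lambda>x. qop X x y) (qcarrier X) (qcarrier X)"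
  using assms by (simp only: quandle_def)

lemma qop_distrib:
  assumes "quandle X" "x \<in> qcarrier X" "y \<in> qcarrier X" "z \<in> qcarrier X"
  shows "qop X (qop X x y) z = qop X (qop X x z) (qop X y z)"
  using assms unfolding quandle_def by blast

lemma qop_idem: "quandle X \<Longrightarrow> x \<in> qcarrier X \<Longrightarrow> qop X x x = x"
  unfolding quandle_def by blast

lemma qop_closed:
  assumes "quandle X" "x \<in> qcarrier X" "y \<in> qcarrier X"
  shows "qop X x y \<in> qcarrier X"
  by (rule bij_betwE[OF quandle_bij_betw[OF assms(1,3)], rule_format, OF assms(2)])

lemma qbar_closed:
  assumes "quandle X" "x \<in> qcarrier X" "y \<in> qcarrier X"
  shows "qbar X x y \<in> qcarrier X"
  unfolding qbar_def
  by (rule bij_betwE[OF bij_betw_the_inv_into[OF quandle_bij_betw[OF assms(1,3)]],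
        rule_format, OF assms(2)])

lemma qop_qbar:
  assumes "quandle X" "x \<in> qcarrier X" "y \<in> qcarrier X"
  shows "qop X (qbar X x y) y = x"
  unfolding qbar_def by (rule f_the_inv_into_f_bij_betw[OF quandle_bij_betw[OF assms(1,3)] assms(2)])

lemma qbar_qop:
  assumes "quandle X" "x \<in> qcarrier X" "y \<in> qcarrier X"
  shows "qbar X (qop X x y) y = x"
  unfolding qbar_def
  by (rule the_inv_into_f_f[OF bij_betw_imp_inj_on[OF quandle_bij_betw[OF assms(1,3)]] assms(2)])

lemma quandle_homD:
  assumes "f \<in> quandle_hom X Y"
  shows "f \<in> qcarrier X \<rightarrow>\<^sub>E qcarrier Y"
    and "x \<in> qcarrier X \<Longrightarrow> f x \<in> qcarrier Y"
    and "x \<in> qcarrier X \<Longrightarrow> y \<in> qcarrier X \<Longrightarrow> f (qop X x y) = qop Y (f x) (f y)"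
  using assms unfolding quandle_hom_def by (blast dest: PiE_mem)+

text \<open>\<open>compose\<close> is \<open>undefined\<close> off the carrier of \<open>X\<close>,
  so closure under \<open>qop X\<close> is what lets it be evaluated at a product.\<close>

lemma quandle_hom_compose:
  assumes "g \<in> quandle_hom X Y" "f \<in> quandle_hom Y Z"
    and "\<And>x y. x \<in> qcarrier X \<Longrightarrow> y \<in> qcarrier X \<Longrightarrow> qop X x y \<in> qcarrier X"
  shows "compose (qcarrier X) f g \<in> quandle_hom X Z"
proof -
  have "compose (qcarrier X) f g \<in> qcarrier X \<rightarrow>\<^sub>E qcarrier Z"
    unfolding compose_def restrict_PiE_iff using quandle_homD(2) assms(1,2) by metis
  moreover have "compose (qcarrier X) f g (qop X x y) =
      qop Z (compose (qcarrier X) f g x) (compose (qcarrier X) f g y)"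
    if "x \<in> qcarrier X" "y \<in> qcarrier X" for x y
    using that assms(3)[OF that] quandle_homD(3)[OF assms(1) that]
      quandle_homD(3)[OF assms(2) quandle_homD(2)[OF assms(1) that(1)]
        quandle_homD(2)[OF assms(1) that(2)]]
    by (simp only: compose_eq)
  ultimately show ?thesis unfolding quandle_hom_def by blast
qed

section \<open>Evaluation of terms and the universal property of a presentation\<close>

primrec qeval :: "'b quandle_structure \<Rightarrow> ('a \<Rightarrow> 'b) \<Rightarrow> 'a qterm \<Rightarrow> 'b" where
  "qeval X c (Gen a) = c a"
| "qeval X c (Op s t) = qop X (qeval X c s) (qeval X c t)"
| "qeval X c (OpBar s t) = qbar X (qeval X c s) (qeval X c t)"

lemma qeval_closed:
  assumes "quandle X" "c \<in> S \<rightarrow> qcarrier X" "t \<in> qterms S"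
  shows "qeval X c t \<in> qcarrier X"
  using assms(3) by (induction t) (use assms in \<open>auto intro: qop_closed qbar_closed\<close>)

text \<open>Soundness of evaluation: the pairs with equal value form a congruence that contains
  \<open>R\<close> and, because \<open>X\<close> is a quandle, the axioms; \<open>qcong\<close> is
  the least such.\<close>

lemma qeval_qcong:
  assumes X: "quandle X" and c: "c \<in> S \<rightarrow> qcarrier X"
    and R: "\<And>s t. (s, t) \<in> R \<Longrightarrow> qeval X c s = qeval X c t"
    and st: "(s, t) \<in> qcong S R"
  shows "qeval X c s = qeval X c t"
  using st
proof induction
  case (idem s)
  then show ?case by (simp add: qop_idem[OF X] qeval_closed[OF X c])
next
  case (op_bar s t)
  then show ?case by (simp add: qbar_qop[OF X] qeval_closed[OF X c])
next
  case (bar_op s t)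
  then show ?case by (simp add: qop_qbar[OF X] qeval_closed[OF X c])
next
  case (distrib s t u)
  then show ?case
    unfolding qeval.simps by (intro qop_distrib X qeval_closed[OF X c])
qed (auto dest: R)

text \<open>Extensional on \<open>S\<close>, so that each coloring is a single function and
  restricting homomorphisms to the generators can be a bijection.\<close>

definition presentation_colorings ::
  "'a set \<Rightarrow> ('a qterm \<times> 'a qterm) set \<Rightarrow> 'b quandle_structure \<Rightarrow> ('a \<Rightarrow> 'b) set" where
  "presentation_colorings S R X =
     {c \<in> S \<rightarrow>\<^sub>E qcarrier X. \<forall>(s, t)\<in>R. qeval X c s = qeval X c t}"

lemma quandle_hom_qclass_Op:
  assumes "f \<in> quandle_hom (presented_quandle S R) X" "s \<in> qterms S" "t \<in> qterms S"
  shows "f (qcong S R `` {Op s t}) = qop X (f (qcong S R `` {s})) (f (qcong S R `` {t}))"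
  unfolding qop_presented_quandle[OF assms(2,3), symmetric]
  using assms(2,3) by (intro quandle_homD(3)[OF assms(1)] qclass_in_presented_quandle)

text \<open>A homomorphism is fixed by its values on generators. By definition it preserves only
  \<open>qop\<close>; the value at \<open>OpBar s t\<close> follows because translating it by the
  image of \<open>t\<close> gives the image of \<open>s\<close>, and right translations of
  \<open>X\<close> are injective.\<close>

lemma quandle_hom_qclass:
  assumes X: "quandle X" and f: "f \<in> quandle_hom (presented_quandle S R) X"
    and t: "t \<in> qterms S"
  shows "f (qcong S R `` {t}) = qeval X (\<lambda>a\<in>S. f (qcong S R `` {Gen a})) t"
  using t
proof (induction t)
  case (Op s t)
  then show ?case by (simp add: quandle_hom_qclass_Op[OF f])
next
  case (OpBar s t)
  let ?Q = "presented_quandle S R" and ?c = "\<lambda>t. qcong S R `` {t}"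
  have mem: "f (?c u) \<in> qcarrier X" if "u \<in> qterms S" for u
    by (rule quandle_homD(2)[OF f qclass_in_presented_quandle[OF that]])
  have "qop X (f (?c (OpBar s t))) (f (?c t)) = f (?c (Op (OpBar s t) t))"
    using OpBar.prems by (simp add: quandle_hom_qclass_Op[OF f])
  also have "?c (Op (OpBar s t) t) = ?c s"
    using OpBar.prems by (intro qclass_eq qcong.bar_op) auto
  finally have "qop X (f (?c (OpBar s t))) (f (?c t)) = f (?c s)" .
  then have "f (?c (OpBar s t)) = qbar X (f (?c s)) (f (?c t))"
    using OpBar.prems mem qbar_qop[OF X, of "f (?c (OpBar s t))" "f (?c t)"] by simp
  then show ?case using OpBar by simp
qed simp

text \<open>Universal property of the presentation: injectivity is determination by generators,
  surjectivity is soundness of evaluation. The rule \<open>qcong.rel\<close> admits only relations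
  between terms over \<open>S\<close>, whence the inclusion for \<open>R\<close>.\<close>

lemma bij_betw_presentation_colorings:
  assumes X: "quandle X" and R: "R \<subseteq> qterms S \<times> qterms S"
  shows "bij_betw (\<lambda>f. \<lambda>a\<in>S. f (qcong S R `` {Gen a}))
    (quandle_hom (presented_quandle S R) X) (presentation_colorings S R X)"
proof (rule bij_betw_imageI)
  let ?Q = "presented_quandle S R" and ?c = "\<lambda>t. qcong S R `` {t}"
  let ?r = "\<lambda>f. \<lambda>a\<in>S. f (?c (Gen a))"
  show "inj_on ?r (quandle_hom ?Q X)"
  proof (rule inj_onI)
    fix f g assume f: "f \<in> quandle_hom ?Q X" and g: "g \<in> quandle_hom ?Q X" and eq: "?r f = ?r g"
    have "f A = g A" if "A \<in> qcarrier ?Q" for A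
      using that by (elim qcarrier_presented_quandleE)
        (simp add: quandle_hom_qclass[OF X f] quandle_hom_qclass[OF X g] eq)
    then show "f = g"
      by (rule PiE_ext[OF quandle_homD(1)[OF f] quandle_homD(1)[OF g]])
  qed
  show "?r ` quandle_hom ?Q X = presentation_colorings S R X"
  proof (intro equalityI subsetI)
    fix c assume "c \<in> ?r ` quandle_hom ?Q X"
    then obtain f where f: "f \<in> quandle_hom ?Q X" and c: "c = ?r f" by blast
    have "c \<in> S \<rightarrow>\<^sub>E qcarrier X"
      unfolding c using f
      by (intro PiE_I) (auto intro!: quandle_homD(2)[OF f] qclass_in_presented_quandle)
    moreover have "qeval X c s = qeval X c t" if st: "(s, t) \<in> R" for s t
    proof -
      have "s \<in> qterms S" "t \<in> qterms S" using R st by auto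
      then show ?thesis
        by (simp add: c quandle_hom_qclass[OF X f, symmetric] qclass_eq[OF qcong.rel[OF st]])
    qed
    ultimately show "c \<in> presentation_colorings S R X"
      by (auto simp: presentation_colorings_def)
  next
    fix c assume c: "c \<in> presentation_colorings S R X"
    then have cS: "c \<in> S \<rightarrow> qcarrier X" and cE: "c \<in> S \<rightarrow>\<^sub>E qcarrier X"
      and cR: "\<And>s t. (s, t) \<in> R \<Longrightarrow> qeval X c s = qeval X c t"
      by (auto simp: presentation_colorings_def)
    \<comment> \<open>The homomorphism evaluates an arbitrary representative of a class; by
      soundness the choice does not affect the value.\<close>
    define f where "f = (\<lambda>A\<in>qcarrier ?Q. qeval X c (SOME t. t \<in> A))"
    have f_c: "f (?c t) = qeval X c t" if t: "t \<in> qterms S" for t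
    proof -
      have "t \<in> ?c t" using t by (simp add: qcong.refl)
      then have "(t, SOME u. u \<in> ?c t) \<in> qcong S R" by (metis Image_singleton_iff someI)
      then show ?thesis
        using qclass_in_presented_quandle[OF t] qeval_qcong[OF X cS cR] by (simp add: f_def)
    qed
    have "f \<in> qcarrier ?Q \<rightarrow>\<^sub>E qcarrier X"
    proof (rule PiE_I)
      fix A assume "A \<in> qcarrier ?Q"
      then show "f A \<in> qcarrier X"
        by (elim qcarrier_presented_quandleE) (simp add: f_c qeval_closed[OF X cS])
    qed (simp add: f_def)
    moreover have "f (qop ?Q A B) = qop X (f A) (f B)"
      if "A \<in> qcarrier ?Q" "B \<in> qcarrier ?Q" for A B
      using that
      by (elim qcarrier_presented_quandleE) (simp add: f_c qop_presented_quandle)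
    ultimately have "f \<in> quandle_hom ?Q X" by (simp add: quandle_hom_def)
    moreover have "c = ?r f"
      by (rule extensionalityI[of _ S]) (use cE in \<open>auto simp: f_c PiE_def\<close>)
    ultimately show "c \<in> ?r ` quandle_hom ?Q X" by blast
  qed
qed

section \<open>Colorings of link diagrams\<close>

text \<open>The color of the incoming under-arc comes first, that of the over-arc second; the value
  is the color of the outgoing under-arc.\<close>

fun crossing_op :: "'b quandle_structure \<Rightarrow> crossing_sign \<Rightarrow> 'b \<Rightarrow> 'b \<Rightarrow> 'b" where
  "crossing_op X Positive = qop X"
| "crossing_op X Negative = qbar X"

lemma crossing_op_closed:
  assumes "quandle X" "x \<in> qcarrier X" "y \<in> qcarrier X"
  shows "crossing_op X s x y \<in> qcarrier X"
  using assms by (cases s) (auto intro: qop_closed qbar_closed)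

definition diagram_colorings :: "'a link_diagram \<Rightarrow> 'b quandle_structure \<Rightarrow> ('a \<Rightarrow> 'b) set" where
  "diagram_colorings D X = {c \<in> diagram_arcs D \<rightarrow>\<^sub>E qcarrier X.
     \<forall>(s, y, x, z)\<in>diagram_crossings D. c z = crossing_op X s (c x) (c y)}"

definition arc_class :: "'a link_diagram \<Rightarrow> 'a \<Rightarrow> 'a qterm set" where
  "arc_class D a = qcong (diagram_arcs D) (crossing_relation ` diagram_crossings D) `` {Gen a}"

text \<open>Each crossing relation evaluates to one coloring condition, so this is the universal
  property of the presentation of the fundamental quandle. The hypothesis on crossings makes both
  sides of their relations terms over the arcs.\<close>

lemma bij_betw_diagram_colorings:
  fixes D :: "'a link_diagram"
  assumes X: "quandle X"
    and D: "\<And>s y x z. (s, y, x, z) \<in> diagram_crossings D \<Longrightarrow> {x, y, z} \<subseteq> diagram_arcs D"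
  shows "bij_betw (\<lambda>f. \<lambda>a\<in>diagram_arcs D. f (arc_class D a))
    (quandle_hom (fundamental_quandle D) X) (diagram_colorings D X)"
proof -
  let ?S = "diagram_arcs D" and ?R = "crossing_relation ` diagram_crossings D"
  have "crossing_relation k \<in> qterms ?S \<times> qterms ?S" if "k \<in> diagram_crossings D" for k
    using that D by (cases k rule: crossing_relation.cases) fastforce+
  then have R: "?R \<subseteq> qterms ?S \<times> qterms ?S" by blast
  have "(case crossing_relation k of (s, t) \<Rightarrow> qeval X c s = qeval X c t) \<longleftrightarrow>
      (case k of (s, y, x, z) \<Rightarrow> c z = crossing_op X s (c x) (c y))"
    for c and k :: "crossing_sign \<times> 'a \<times> 'a \<times> 'a"
    by (cases k rule: crossing_relation.cases) auto
  then have "presentation_colorings ?S ?R X = diagram_colorings D X"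
    by (simp add: presentation_colorings_def diagram_colorings_def)
  then show ?thesis
    using bij_betw_presentation_colorings[OF X R]
    by (simp add: fundamental_quandle_def arc_class_def)
qed

section \<open>Colorings of closed braids\<close>

text \<open>Passage of a row of colors through one letter: the over-strand keeps its color and
  leaves at \<open>under_pos l\<close>, the under-strand emerges recolored at
  \<open>over_pos l\<close>.\<close>

definition braid_act :: "'b quandle_structure \<Rightarrow> crossing_sign \<times> nat \<Rightarrow> (nat \<Rightarrow> 'b) \<Rightarrow> nat \<Rightarrow> 'b" where
  "braid_act X l x = x(under_pos l := x (over_pos l),
     over_pos l := crossing_op X (fst l) (x (under_pos l)) (x (over_pos l)))"

definition closed_braid_colorings ::
  "nat \<Rightarrow> braid_word \<Rightarrow> 'b quandle_structure \<Rightarrow> (nat \<Rightarrow> 'b) set" where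
  "closed_braid_colorings p w X =
     {x \<in> {1..p} \<rightarrow>\<^sub>E qcarrier X. \<forall>j\<in>{1..p}. fold (braid_act X) w x j = x j}"

lemma over_pos_neq_under_pos: "over_pos l \<noteq> under_pos l"
  by (cases l rule: over_pos.cases) auto

lemma braid_act_simps:
  "braid_act X l x (under_pos l) = x (over_pos l)"
  "braid_act X l x (over_pos l) = crossing_op X (fst l) (x (under_pos l)) (x (over_pos l))"
  "j \<noteq> over_pos l \<Longrightarrow> j \<noteq> under_pos l \<Longrightarrow> braid_act X l x j = x j"
  using over_pos_neq_under_pos[of l] by (auto simp: braid_act_def)

lemma crossing_pos_in_range:
  assumes "snd l \<in> {1..<p}"
  shows "over_pos l \<in> {1..p}" "under_pos l \<in> {1..p}"
  using assms by (cases l rule: over_pos.cases; auto)+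

lemma crossing_pos_nth_in_range:
  assumes "snd ` set w \<subseteq> {1..<p}" "t < length w"
  shows "over_pos (w ! t) \<in> {1..p}" "under_pos (w ! t) \<in> {1..p}"
proof -
  have "snd (w ! t) \<in> {1..<p}" using assms by force
  then show "over_pos (w ! t) \<in> {1..p}" "under_pos (w ! t) \<in> {1..p}"
    by (rule crossing_pos_in_range)+
qed

lemma braid_act_closed:
  assumes "quandle X" "x \<in> {1..p} \<rightarrow> qcarrier X" "snd l \<in> {1..<p}"
  shows "braid_act X l x \<in> {1..p} \<rightarrow> qcarrier X"
  using assms crossing_pos_in_range[OF assms(3)]
  by (auto simp: Pi_iff braid_act_def intro!: crossing_op_closed)

lemma fold_braid_act_closed:
  assumes "quandle X" "x \<in> {1..p} \<rightarrow> qcarrier X" "snd ` set w \<subseteq> {1..<p}"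
  shows "fold (braid_act X) w x \<in> {1..p} \<rightarrow> qcarrier X"
  using assms(2,3)
proof (induction w arbitrary: x)
  case (Cons l w)
  have "braid_act X l x \<in> {1..p} \<rightarrow> qcarrier X"
    using Cons.prems by (intro braid_act_closed assms(1)) auto
  then show ?case using Cons.IH Cons.prems(2) by auto
qed simp

lemma fold_take_Suc:
  assumes "t < length w"
  shows "fold f (take (Suc t) w) x = f (w ! t) (fold f (take t w) x)"
  using assms by (simp add: take_Suc_conv_app_nth)

lemma arc_of_refl: "x \<in> arc_of p w x"
  by (simp add: arc_of_def)

lemma arc_of_step:
  assumes "(x, y) \<in> arc_step p w"
  shows "arc_of p w x = arc_of p w y"
proof -
  let ?R = "(arc_step p w \<union> (arc_step p w)\<inverse>)\<^sup>*"
  have "(x, y) \<in> ?R" "(y, x) \<in> ?R" using assms by auto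
  then show ?thesis unfolding arc_of_def by (auto intro: rtrancl_trans)
qed

text \<open>A function on points that is constant along steps factors through arcs; this allows a
  coloring to be built point by point.\<close>

lemma arc_of_invariant:
  assumes "\<And>x y. (x, y) \<in> arc_step p w \<Longrightarrow> g x = g y" and "y \<in> arc_of p w x"
  shows "g y = g x"
proof -
  have "(x, y) \<in> (arc_step p w \<union> (arc_step p w)\<inverse>)\<^sup>*" using assms(2) by (simp add: arc_of_def)
  then show ?thesis by induction (use assms(1) in auto)
qed

text \<open>Induction upward through the word. Along an over-strand or an untouched strand the arc
  does not change; the under-strand changes arc at the crossing, where the coloring condition
  supplies the new color.\<close>

lemma braid_closure_coloring_state:
  assumes w: "snd ` set w \<subseteq> {1..<p}"
    and c: "c \<in> diagram_colorings (braid_closure p w) X"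
    and x: "\<And>j. j \<in> {1..p} \<Longrightarrow> x j = c (arc_of p w (j, 0))"
    and t: "t \<le> length w" and j: "j \<in> {1..p}"
  shows "c (arc_of p w (j, t)) = fold (braid_act X) (take t w) x j"
  using t j
proof (induction t arbitrary: j)
  case (Suc t)
  let ?s = "fold (braid_act X) (take t w) x" and ?l = "w ! t"
  have t: "t < length w" using Suc.prems by simp
  then have l: "over_pos ?l \<in> {1..p}" "under_pos ?l \<in> {1..p}"
    using crossing_pos_nth_in_range w by blast+
  have cross: "c (arc_of p w (over_pos ?l, Suc t)) =
      crossing_op X (fst ?l) (c (arc_of p w (under_pos ?l, t))) (c (arc_of p w (over_pos ?l, t)))"
    using c t by (fastforce simp: diagram_colorings_def braid_closure_def)
  consider "j = over_pos ?l" | "j = under_pos ?l" | "j \<noteq> over_pos ?l" "j \<noteq> under_pos ?l" by blast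
  then have "c (arc_of p w (j, Suc t)) = braid_act X ?l ?s j"
  proof cases
    case 1
    then show ?thesis using cross Suc.IH l t by (simp add: braid_act_simps)
  next
    case 2
    have "arc_of p w (under_pos ?l, Suc t) = arc_of p w (over_pos ?l, t)"
      using t by (intro arc_of_step[symmetric]) (auto simp: arc_step_def)
    then show ?thesis using 2 Suc.IH[of "over_pos ?l"] l t by (simp add: braid_act_simps)
  next
    case 3
    have "arc_of p w (j, Suc t) = arc_of p w (j, t)"
      using t 3 Suc.prems by (intro arc_of_step[symmetric]) (auto simp: arc_step_def)
    then show ?thesis using 3 Suc t by (simp add: braid_act_simps)
  qed
  then show ?case using t by (simp only: fold_take_Suc)
qed (simp add: x)

lemma braid_crossing_arcs:
  assumes "snd ` set w \<subseteq> {1..<p}" "(s, y, x, z) \<in> diagram_crossings (braid_closure p w)"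
  shows "{x, y, z} \<subseteq> diagram_arcs (braid_closure p w)"
proof -
  obtain t where t: "t < length w" and xyz: "y = arc_of p w (over_pos (w ! t), t)"
      "x = arc_of p w (under_pos (w ! t), t)" "z = arc_of p w (over_pos (w ! t), Suc t)"
    using assms(2) by (auto simp: braid_closure_def)
  have "over_pos (w ! t) \<in> {1..p}" "under_pos (w ! t) \<in> {1..p}"
    using crossing_pos_nth_in_range t assms(1) by blast+
  then show ?thesis using t by (auto simp: xyz braid_closure_def braid_points_def)
qed

text \<open>A coloring is determined by its bottom row, since the rows above follow by the braid
  action. Conversely a bottom row spreads upward, and being fixed by the whole word is exactly
  consistency with the closing strands.\<close>

lemma bij_betw_closed_braid_colorings:
  assumes X: "quandle X" and w: "snd ` set w \<subseteq> {1..<p}"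
  shows "bij_betw (\<lambda>c. \<lambda>j\<in>{1..p}. c (arc_of p w (j, 0)))
    (diagram_colorings (braid_closure p w) X) (closed_braid_colorings p w X)"
proof (rule bij_betw_imageI)
  let ?D = "braid_closure p w" and ?r = "\<lambda>c. \<lambda>j\<in>{1..p}. c (arc_of p w (j, 0))"
  have arcs: "diagram_arcs ?D = arc_of p w ` braid_points p w"
    by (simp add: braid_closure_def)
  show "inj_on ?r (diagram_colorings ?D X)"
  proof (rule inj_onI)
    fix c c' assume c: "c \<in> diagram_colorings ?D X" "c' \<in> diagram_colorings ?D X"
      and eq: "?r c = ?r c'"
    have "c (arc_of p w (j, t)) = c' (arc_of p w (j, t))"
      if jt: "j \<in> {1..p}" "t \<le> length w" for j t
    proof -
      let ?x = "\<lambda>i. c (arc_of p w (i, 0))"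
      have "?x i = c' (arc_of p w (i, 0))" if "i \<in> {1..p}" for i
        using that fun_cong[OF eq, of i] by simp
      then have "c' (arc_of p w (j, t)) = fold (braid_act X) (take t w) ?x j"
        by (rule braid_closure_coloring_state[OF w c(2) _ jt(2,1)])
      then show ?thesis
        using braid_closure_coloring_state[OF w c(1) HOL.refl jt(2,1)] by simp
    qed
    then have "c a = c' a" if "a \<in> diagram_arcs ?D" for a
      using that by (auto simp: arcs braid_points_def)
    then show "c = c'" using c by (auto simp: diagram_colorings_def intro: PiE_ext)
  qed
  show "?r ` diagram_colorings ?D X = closed_braid_colorings p w X"
  proof (intro equalityI subsetI)
    fix x assume "x \<in> ?r ` diagram_colorings ?D X"
    then obtain c where c: "c \<in> diagram_colorings ?D X" and x: "x = ?r c" by blast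
    have "fold (braid_act X) w x j = x j" if j: "j \<in> {1..p}" for j
    proof -
      have "fold (braid_act X) w x j = c (arc_of p w (j, length w))"
        using braid_closure_coloring_state[OF w c _ order.refl j, of x] by (simp add: x)
      also have "arc_of p w (j, length w) = arc_of p w (j, 0)"
        using j by (intro arc_of_step) (auto simp: arc_step_def)
      also have "c (arc_of p w (j, 0)) = x j" using j by (simp add: x)
      finally show ?thesis .
    qed
    moreover have "c (arc_of p w (j, 0)) \<in> qcarrier X" if "j \<in> {1..p}" for j
    proof -
      have "c \<in> diagram_arcs ?D \<rightarrow>\<^sub>E qcarrier X" using c by (simp add: diagram_colorings_def)
      moreover have "arc_of p w (j, 0) \<in> diagram_arcs ?D"
        using that by (simp add: arcs braid_points_def)
      ultimately show ?thesis by (rule PiE_mem)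
    qed
    then have "x \<in> {1..p} \<rightarrow>\<^sub>E qcarrier X"
      unfolding x restrict_PiE_iff by blast
    ultimately show "x \<in> closed_braid_colorings p w X"
      by (simp add: closed_braid_colorings_def)
  next
    fix x assume x: "x \<in> closed_braid_colorings p w X"
    \<comment> \<open>\<open>g\<close> colors the points of the braid level by level;
      \<open>c\<close> reads it at an arbitrary point of each arc, which is harmless once
      \<open>g\<close> is constant along steps.\<close>
    define g where "g = (\<lambda>(j, t). fold (braid_act X) (take t w) x j)"
    define c where "c = (\<lambda>a\<in>diagram_arcs ?D. g (SOME y. y \<in> a))"
    have xE: "x \<in> {1..p} \<rightarrow>\<^sub>E qcarrier X" and x_closed: "\<And>j. j \<in> {1..p} \<Longrightarrow> fold (braid_act X) w x j = x j"
      using x by (auto simp: closed_braid_colorings_def)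
    have g_step: "g u = g v" if "(u, v) \<in> arc_step p w" for u v
      using that x_closed by (auto simp: arc_step_def g_def fold_take_Suc braid_act_simps)
    have c_arc: "c (arc_of p w u) = g u" if "u \<in> braid_points p w" for u
    proof -
      have "(SOME y. y \<in> arc_of p w u) \<in> arc_of p w u" using arc_of_refl by (rule someI)
      then have "g (SOME y. y \<in> arc_of p w u) = g u"
        by (rule arc_of_invariant[of p w g, rotated]) (rule g_step)
      then show ?thesis using that by (simp add: c_def arcs)
    qed
    have "c \<in> diagram_arcs ?D \<rightarrow>\<^sub>E qcarrier X"
    proof (rule PiE_I)
      fix a assume "a \<in> diagram_arcs ?D"
      then obtain j t where jt: "a = arc_of p w (j, t)" "(j, t) \<in> braid_points p w" "j \<in> {1..p}"
        by (auto simp: arcs braid_points_def)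
      have "fold (braid_act X) (take t w) x \<in> {1..p} \<rightarrow> qcarrier X"
        using xE w by (intro fold_braid_act_closed X) (auto dest: in_set_takeD)
      then show "c a \<in> qcarrier X" using jt by (auto simp: c_arc g_def)
    qed (simp add: c_def)
    moreover have "c z = crossing_op X s (c u) (c y)"
      if k: "(s, y, u, z) \<in> diagram_crossings ?D" for s y u z
    proof -
      obtain t where t: "t < length w" and k': "s = fst (w ! t)" "y = arc_of p w (over_pos (w ! t), t)"
          "u = arc_of p w (under_pos (w ! t), t)" "z = arc_of p w (over_pos (w ! t), Suc t)"
        using k by (auto simp: braid_closure_def)
      have "over_pos (w ! t) \<in> {1..p}" "under_pos (w ! t) \<in> {1..p}"
        using crossing_pos_nth_in_range t w by blast+
      then have "(over_pos (w ! t), t) \<in> braid_points p w" "(under_pos (w ! t), t) \<in> braid_points p w"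
          "(over_pos (w ! t), Suc t) \<in> braid_points p w"
        using t by (auto simp: braid_points_def)
      then show ?thesis using t by (simp add: k' c_arc g_def fold_take_Suc braid_act_simps)
    qed
    ultimately have "c \<in> diagram_colorings ?D X" by (auto simp: diagram_colorings_def)
    moreover have "x = ?r c"
      by (rule extensionalityI[of _ "{1..p}"])
        (use xE in \<open>auto simp: c_arc braid_points_def g_def PiE_def\<close>)
    ultimately show "x \<in> ?r ` diagram_colorings ?D X" by blast
  qed
qed

section \<open>The torus braid acting on tuples of colors\<close>

text \<open>The first strand passes over all others to position \<open>p\<close>, so every other
  color is acted on by \<open>x 1\<close> and moves one place to the left. Entries outside
  \<open>{1..p}\<close> are kept, so that agreement with the fold is an equality of
  functions.\<close>

definition row_act :: "'b quandle_structure \<Rightarrow> nat \<Rightarrow> (nat \<Rightarrow> 'b) \<Rightarrow> nat \<Rightarrow> 'b" where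
  "row_act X p x j =
     (if j \<in> {1..<p} then qop X (x (Suc j)) (x 1) else if j = p then x 1 else x j)"

text \<open>When the word for \<open>p\<close> is extended by one letter, the first strand, still of
  color \<open>x 1\<close>, stands at position \<open>p\<close> and passes over the untouched strand
  at \<open>Suc p\<close>.\<close>

lemma fold_braid_act_row_word:
  assumes "p > 0"
  shows "fold (braid_act X) (map (Pair Positive) [1..<p]) = row_act X p"
  using assms
proof (induction p rule: nat_induct_non_zero)
  case 1
  then show ?case by (auto simp: row_act_def fun_eq_iff)
next
  case (Suc p)
  then show ?case by (auto simp: row_act_def braid_act_def fun_eq_iff)
qed

lemma fold_braid_act_torus:
  assumes "p > 0"
  shows "fold (braid_act X) (torus_braid p q) = row_act X p ^^ q"
proof (induction q)
  case (Suc q)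
  have "torus_braid p (Suc q) = map (Pair Positive) [1..<p] @ torus_braid p q"
    by (simp add: torus_braid_def)
  then show ?case
    by (simp only: fold_append fold_braid_act_row_word[OF assms] Suc funpow_Suc_right ext comp_apply)
qed (simp add: torus_braid_def fun_eq_iff)

definition torus_colorings :: "nat \<Rightarrow> nat \<Rightarrow> 'b quandle_structure \<Rightarrow> (nat \<Rightarrow> 'b) set" where
  "torus_colorings p q X =
     {x \<in> {1..p} \<rightarrow>\<^sub>E qcarrier X. \<forall>j\<in>{1..p}. (row_act X p ^^ q) x j = x j}"

definition bottom_class :: "nat \<Rightarrow> nat \<Rightarrow> nat \<Rightarrow> (nat \<times> nat) set qterm set" where
  "bottom_class p q j = arc_class (torus_link p q) (arc_of p (torus_braid p q) (j, 0))"

lemma bottom_class_in_fundamental_quandle: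
  assumes "j \<in> {1..p}"
  shows "bottom_class p q j \<in> qcarrier (fundamental_quandle (torus_link p q))"
  unfolding bottom_class_def arc_class_def fundamental_quandle_def
  using assms by (intro qclass_in_presented_quandle)
    (auto simp: torus_link_def braid_closure_def braid_points_def)

text \<open>Two bijections are composed: homomorphisms correspond to diagram colorings, and
  colorings of a closed braid to their bottom rows.\<close>

lemma bij_betw_torus_colorings:
  fixes X :: "'b quandle_structure"
  assumes X: "quandle X" and p: "p > 0"
  shows "bij_betw (\<lambda>f. \<lambda>j\<in>{1..p}. f (bottom_class p q j))
    (quandle_hom (fundamental_quandle (torus_link p q)) X) (torus_colorings p q X)"
proof -
  let ?w = "torus_braid p q" and ?D = "torus_link p q"
  have w: "snd ` set ?w \<subseteq> {1..<p}" by (auto simp: torus_braid_def)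
  have bij1: "bij_betw (\<lambda>f. \<lambda>a\<in>diagram_arcs ?D. f (arc_class ?D a))
    (quandle_hom (fundamental_quandle ?D) X) (diagram_colorings ?D X)"
    by (rule bij_betw_diagram_colorings[OF X])
      (auto simp: torus_link_def dest: braid_crossing_arcs[OF w])
  have bij2: "bij_betw (\<lambda>c. \<lambda>j\<in>{1..p}. c (arc_of p ?w (j, 0)))
      (diagram_colorings ?D X) (torus_colorings p q X)"
    using bij_betw_closed_braid_colorings[OF X w]
    by (simp add: torus_link_def torus_colorings_def closed_braid_colorings_def
        fold_braid_act_torus[OF p])
  have "arc_of p ?w (j, 0) \<in> diagram_arcs ?D" if "j \<in> {1..p}" for j
    using that by (auto simp: torus_link_def braid_closure_def braid_points_def)
  then have "((\<lambda>c. \<lambda>j\<in>{1..p}. c (arc_of p ?w (j, 0))) \<circ>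
      (\<lambda>f. \<lambda>a\<in>diagram_arcs ?D. f (arc_class ?D a))) f = (\<lambda>j\<in>{1..p}. f (bottom_class p q j))"
    for f :: "(nat \<times> nat) set qterm set \<Rightarrow> 'b"
    by (auto simp: bottom_class_def fun_eq_iff restrict_def)
  then show ?thesis
    using bij_betw_trans[OF bij1 bij2] by (simp only: cong: bij_betw_cong)
qed

lemma row_act_closed:
  assumes "quandle X" "p > 0" "x \<in> {1..p} \<rightarrow> qcarrier X"
  shows "row_act X p x \<in> {1..p} \<rightarrow> qcarrier X"
  using assms by (auto simp: Pi_iff row_act_def intro!: qop_closed)

lemma row_act_funpow_closed:
  assumes "quandle X" "p > 0" "x \<in> {1..p} \<rightarrow> qcarrier X"
  shows "(row_act X p ^^ k) x \<in> {1..p} \<rightarrow> qcarrier X"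
  by (induction k) (use assms row_act_closed[OF assms(1,2)] in simp_all)

lemma row_act_cong:
  assumes "\<And>j. j \<in> {1..p} \<Longrightarrow> x j = y j" "j \<in> {1..p}"
  shows "row_act X p x j = row_act X p y j"
  using assms by (auto simp: row_act_def)

lemma row_act_funpow_cong:
  assumes "\<And>j. j \<in> {1..p} \<Longrightarrow> x j = y j" "j \<in> {1..p}"
  shows "(row_act X p ^^ k) x j = (row_act X p ^^ k) y j"
  using assms(2)
proof (induction k arbitrary: j)
  case (Suc k)
  then show ?case using row_act_cong[of p "(row_act X p ^^ k) x"] by simp
qed (simp add: assms(1))

text \<open>\<open>row_act\<close> is built from the quandle operation, with which homomorphisms
  commute. The iterated tuple has to stay in the carrier, as \<open>f\<close> is controlled only
  there.\<close>

lemma row_act_funpow_hom: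
  assumes X: "quandle X" and p: "p > 0" and x: "x \<in> {1..p} \<rightarrow> qcarrier X"
    and f: "f \<in> quandle_hom X Y" and j: "j \<in> {1..p}"
  shows "(row_act Y p ^^ k) (compose {1..p} f x) j = f ((row_act X p ^^ k) x j)"
  using j
proof (induction k arbitrary: j)
  case 0
  then show ?case by (simp add: compose_def)
next
  case (Suc k)
  let ?y = "(row_act X p ^^ k) x"
  have y: "?y i \<in> qcarrier X" if "i \<in> {1..p}" for i
    using row_act_funpow_closed[OF X p x] that by (rule Pi_mem)
  have "(row_act Y p ^^ Suc k) (compose {1..p} f x) j = row_act Y p (\<lambda>i. f (?y i)) j"
    using Suc row_act_cong[of p "(row_act Y p ^^ k) (compose {1..p} f x)" "\<lambda>i. f (?y i)" j Y]
    by simp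
  also have "\<dots> = f (row_act X p ?y j)"
    using Suc.prems p y by (auto simp: row_act_def quandle_homD(3)[OF f])
  finally show ?case by simp
qed

text \<open>Colorings are functorial in the quandle. This is applied below to translations, negation
  and the zero map of a dihedral quandle.\<close>

lemma torus_colorings_compose:
  assumes X: "quandle X" and p: "p > 0" and x: "x \<in> torus_colorings p q X"
    and f: "f \<in> quandle_hom X Y"
  shows "compose {1..p} f x \<in> torus_colorings p q Y"
proof -
  have xE: "x \<in> {1..p} \<rightarrow> qcarrier X" and fix_x: "\<And>j. j \<in> {1..p} \<Longrightarrow> (row_act X p ^^ q) x j = x j"
    using x by (auto simp: torus_colorings_def)
  have "compose {1..p} f x \<in> {1..p} \<rightarrow>\<^sub>E qcarrier Y"
    unfolding compose_def restrict_PiE_iff using quandle_homD(2)[OF f] Pi_mem[OF xE] by blast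
  then show ?thesis
    using row_act_funpow_hom[OF X p xE f] fix_x
    by (simp add: torus_colorings_def compose_def)
qed

text \<open>\<open>row_act\<close> commutes with its own powers, so it preserves the tuples fixed by
  its \<open>q\<close>-th power. The restriction restores extensionality.\<close>

lemma torus_colorings_row_act:
  assumes X: "quandle X" and p: "p > 0" and x: "x \<in> torus_colorings p q X"
  shows "restrict (row_act X p x) {1..p} \<in> torus_colorings p q X"
proof -
  have xE: "x \<in> {1..p} \<rightarrow> qcarrier X" and fix_x: "\<And>j. j \<in> {1..p} \<Longrightarrow> (row_act X p ^^ q) x j = x j"
    using x by (auto simp: torus_colorings_def)
  have "(row_act X p ^^ q) (restrict (row_act X p x) {1..p}) j =
      restrict (row_act X p x) {1..p} j" if j: "j \<in> {1..p}" for j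
  proof -
    have "(row_act X p ^^ q) (restrict (row_act X p x) {1..p}) j =
        (row_act X p ^^ q) (row_act X p x) j"
      using j by (intro row_act_funpow_cong) simp_all
    also have "\<dots> = row_act X p ((row_act X p ^^ q) x) j"
      by (simp only: funpow_swap1)
    also have "\<dots> = row_act X p x j"
      using fix_x j by (rule row_act_cong)
    finally show ?thesis using j by simp
  qed
  moreover have "restrict (row_act X p x) {1..p} \<in> {1..p} \<rightarrow>\<^sub>E qcarrier X"
    unfolding restrict_PiE_iff using row_act_closed[OF X p xE] by blast
  ultimately show ?thesis unfolding torus_colorings_def by blast
qed

section \<open>Dihedral quandles\<close>

lemma qcarrier_dihedral [simp]: "qcarrier (dihedral_quandle n) = {0..<int n}"
  and qop_dihedral [simp]: "qop (dihedral_quandle n) x y = (2 * y - x) mod int n"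
  by (simp_all add: dihedral_quandle_def)

lemma dihedral_op_mod:
  fixes x y n :: int
  shows "(2 * (y mod n) - x mod n) mod n = (2 * y - x) mod n"
proof -
  have "(2 * (y mod n) - x mod n) mod n = ((2 * (y mod n)) mod n - x mod n) mod n"
    by (simp only: mod_diff_left_eq)
  then show ?thesis by (simp only: mod_mult_right_eq mod_diff_eq)
qed

definition affine_map :: "nat \<Rightarrow> int \<Rightarrow> int \<Rightarrow> int \<Rightarrow> int" where
  "affine_map n b c = (\<lambda>y\<in>{0..<int n}. (b + c * y) mod int n)"

text \<open>The coefficients of \<open>2 * y - x\<close> add up to 1, so the constant term
  \<open>b\<close> is reproduced.\<close>

lemma affine_map_in_quandle_hom:
  assumes "n > 0"
  shows "affine_map n b c \<in> quandle_hom (dihedral_quandle n) (dihedral_quandle n)"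
proof -
  have "(b + c * ((2 * y - x) mod int n)) mod int n =
      (2 * ((b + c * y) mod int n) - (b + c * x) mod int n) mod int n" for x y
  proof -
    have "(2 * ((b + c * y) mod int n) - (b + c * x) mod int n) mod int n =
        (2 * (b + c * y) - (b + c * x)) mod int n"
      by (rule dihedral_op_mod)
    also have "2 * (b + c * y) - (b + c * x) = b + c * (2 * y - x)"
      by (simp add: algebra_simps)
    also have "(b + c * (2 * y - x)) mod int n = (b + c * ((2 * y - x) mod int n)) mod int n"
      by (metis mod_add_right_eq mod_mult_right_eq)
    finally show ?thesis by simp
  qed
  then show ?thesis
    using assms by (auto simp: quandle_hom_def affine_map_def)
qed

text \<open>In a dihedral quandle \<open>i + 1\<close> acting on \<open>i\<close> gives
  \<open>i + 2\<close>. Hence the values at 0 and 1 determine all others through the recurrence of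
  an arithmetic progression.\<close>

lemma dihedral_endomorphism_affine:
  assumes n: "n > 0" and f: "f \<in> quandle_hom (dihedral_quandle n) (dihedral_quandle n)"
  obtains b c where "b \<in> {0..<int n}" "c \<in> {0..<int n}" "f = affine_map n b c"
proof -
  define b where "b = f 0"
  \<comment> \<open>For \<open>n = 1\<close> the integer 1 is not in the carrier;
    \<open>1 mod int n\<close> is then 0 and the slope becomes 0.\<close>
  define c where "c = f (1 mod int n) - f 0"
  have f_mem: "f y \<in> {0..<int n}" if "y \<in> {0..<int n}" for y
    using quandle_homD(2)[OF f] that by simp
  have f_arith: "f (int i mod int n) = (b + c * int i) mod int n" for i
  proof (induction i rule: induct_nat_012)
    case 0
    then show ?case using f_mem[of 0] n by (simp add: b_def)
  next
    case 1
    then show ?case using f_mem[of "1 mod int n"] n by (simp add: b_def c_def)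
  next
    case (ge2 i)
    let ?u = "int i mod int n" and ?v = "int (Suc i) mod int n"
    have "int (Suc (Suc i)) mod int n = (2 * int (Suc i) - int i) mod int n"
      by (simp add: algebra_simps)
    also have "\<dots> = (2 * ?v - ?u) mod int n"
      by (rule dihedral_op_mod[symmetric])
    also have "\<dots> = qop (dihedral_quandle n) ?u ?v" by simp
    finally have "f (int (Suc (Suc i)) mod int n) = f (qop (dihedral_quandle n) ?u ?v)"
      by (rule arg_cong)
    also have "\<dots> = qop (dihedral_quandle n) (f ?u) (f ?v)"
      using n by (intro quandle_homD(3)[OF f]) simp_all
    also have "\<dots> = (2 * f ?v - f ?u) mod int n" by (rule qop_dihedral)
    also have "\<dots> = (2 * (b + c * int (Suc i)) - (b + c * int i)) mod int n"
      unfolding ge2.IH by (rule dihedral_op_mod)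
    also have "2 * (b + c * int (Suc i)) - (b + c * int i) = b + c * int (Suc (Suc i))"
      by (simp add: algebra_simps)
    finally show ?case .
  qed
  have "f y = affine_map n b (c mod int n) y" if "y \<in> {0..<int n}" for y
  proof -
    have "f y = (b + c * y) mod int n" using f_arith[of "nat y"] that by simp
    also have "\<dots> = (b + (c mod int n) * y) mod int n"
      by (intro mod_add_cong mod_mult_cong) simp_all
    finally show ?thesis using that by (simp add: affine_map_def)
  qed
  then have f_eq: "f = affine_map n b (c mod int n)"
    by (intro PiE_ext[OF quandle_homD(1)[OF f]
          quandle_homD(1)[OF affine_map_in_quandle_hom[OF n]]]) simp
  have "b \<in> {0..<int n}" unfolding b_def using n by (intro f_mem) simp
  moreover have "c mod int n \<in> {0..<int n}" using n by simp
  ultimately show ?thesis using f_eq by (rule that)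
qed

lemma quandle_hom_dihedral:
  assumes "n > 0"
  shows "quandle_hom (dihedral_quandle n) (dihedral_quandle n) =
    case_prod (affine_map n) ` ({0..<int n} \<times> {0..<int n})"
proof (intro equalityI subsetI)
  fix f assume "f \<in> quandle_hom (dihedral_quandle n) (dihedral_quandle n)"
  then show "f \<in> case_prod (affine_map n) ` ({0..<int n} \<times> {0..<int n})"
    using assms by (elim dihedral_endomorphism_affine[rotated]) auto
qed (auto intro: affine_map_in_quandle_hom[OF assms])

lemma inj_on_affine_map:
  "inj_on (case_prod (affine_map n)) ({0..<int n} \<times> {0..<int n})"
proof (rule inj_onI; clarify)
  fix b c b' c' assume mem: "b \<in> {0..<int n}" "c \<in> {0..<int n}" "b' \<in> {0..<int n}" "c' \<in> {0..<int n}"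
    and eq: "affine_map n b c = affine_map n b' c'"
  have b: "b = b'" using fun_cong[OF eq, of 0] mem by (simp add: affine_map_def)
  have "c = c'"
  \<comment> \<open>Slopes are compared at the point 1, which lies in the carrier only for
    \<open>n > 1\<close>; otherwise there is at most one slope.\<close>
  proof (cases "n > 1")
    case True
    then have "(b + c) mod int n = (b + c') mod int n"
      using fun_cong[OF eq, of 1] b by (simp add: affine_map_def)
    then have "c mod int n = c' mod int n" by (metis add_diff_cancel_left' mod_diff_left_eq)
    then show ?thesis using mem by simp
  next
    case False
    then show ?thesis using mem by auto
  qed
  with b show "b = b' \<and> c = c'" by simp
qed

section \<open>Shift-closed sets of sequences of prime period\<close>

text \<open>The shifts of a nonconstant sequence of prime period \<open>p\<close> are \<open>p\<close> distinct sequences,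
  which leaves no room for the fixed point \<open>e\<close>.\<close>

lemma constant_if_shift_closed:
  fixes D :: "(nat \<Rightarrow> 'a) set"
  assumes p: "prime p" and D: "finite D" "card D = p"
    and per: "\<And>d i. d \<in> D \<Longrightarrow> d (i + p) = d i"
    and shift: "\<And>d. d \<in> D \<Longrightarrow> (\<lambda>i. d (Suc i)) \<in> D"
    and e: "e \<in> D" "\<And>i. e (Suc i) = e i" and d: "d \<in> D"
  shows "d i = d 0"
proof (rule ccontr)
  assume nonconst: "d i \<noteq> d 0"
  have per_mult: "d (i + k * p) = d i" for i k
  proof (induction k)
    case (Suc k)
    then show ?case using per[OF d, of "i + k * p"] by (simp add: algebra_simps)
  qed simp
  have shift_mem: "(\<lambda>i. d (i + k)) \<in> D" for k
  proof (induction k)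
    case (Suc k)
    from shift[OF Suc] show ?case by simp
  qed (simp add: d)
  have shift_neq: "(\<lambda>i. d (i + k)) \<noteq> (\<lambda>i. d (i + l))" if kl: "k < l" "l < p" for k l
  proof
    assume eq: "(\<lambda>i. d (i + k)) = (\<lambda>i. d (i + l))"
    \<comment> \<open>The distance of two equal shifts is a period of \<open>d\<close>. Being
      positive and below the prime \<open>p\<close> it is coprime to \<open>p\<close>, and Bezout
      then yields period 1.\<close>
    define m where "m = l - k"
    have m_per: "d (i + m) = d i" for i
    proof -
      \<comment> \<open>Adding \<open>k * p\<close> avoids subtracting \<open>k\<close> from the
        index: the sum splits as \<open>l\<close> plus \<open>i + k * (p - 1)\<close>, and
        \<open>eq\<close> replaces \<open>l\<close> by \<open>k\<close>.\<close>
      have "d (i + m) = d (i + m + k * p)" by (rule per_mult[symmetric])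
      also have "i + m + k * p = (i + k * (p - 1)) + l"
        using kl by (cases p) (simp_all add: m_def algebra_simps)
      also have "d \<dots> = d ((i + k * (p - 1)) + k)" using fun_cong[OF eq] by simp
      also have "(i + k * (p - 1)) + k = i + k * p" using kl by (cases p) simp_all
      finally show ?thesis by (simp add: per_mult)
    qed
    have m_mult: "d (i + m * x) = d i" for i x
    proof (induction x)
      case (Suc x)
      then show ?case using m_per[of "i + m * x"] by (simp add: algebra_simps)
    qed simp
    have "coprime m p"
      using kl p by (intro prime_imp_coprime[THEN coprime_commute[THEN iffD1]])
        (auto simp: m_def dest: dvd_imp_le)
    moreover have "m \<noteq> 0" using kl by (simp add: m_def)
    ultimately obtain x y where xy: "m * x = p * y + 1"
      using bezout_nat[of m p] by (auto simp: coprime_iff_gcd_eq_1)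
    have "d (Suc i) = d i" for i
    proof -
      have "d i = d (i + m * x)" by (rule m_mult[symmetric])
      also have "i + m * x = Suc i + y * p" by (simp add: xy)
      finally show ?thesis by (simp only: per_mult)
    qed
    then have "d i = d 0" for i by (induction i) simp_all
    then show False using nonconst by blast
  qed
  have inj: "inj_on (\<lambda>k i. d (i + k)) {..<p}"
  proof (rule inj_onI)
    fix k l assume "k \<in> {..<p}" "l \<in> {..<p}" "(\<lambda>i. d (i + k)) = (\<lambda>i. d (i + l))"
    then show "k = l" using shift_neq[of k l] shift_neq[of l k] by (cases k l rule: linorder_cases) auto
  qed
  have e_notin: "e \<notin> (\<lambda>k i. d (i + k)) ` {..<p}"
  proof
    assume "e \<in> (\<lambda>k i. d (i + k)) ` {..<p}"
    then obtain k where k: "k < p" and ek: "e = (\<lambda>i. d (i + k))" by blast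
    \<comment> \<open>A constant shift of \<open>d\<close> would make \<open>d\<close> itself
      constant, since modulo \<open>p\<close> every index is a shifted one.\<close>
    have "e i = e 0" for i by (induction i) (simp_all add: e(2))
    then have "d (i + k) = d k" for i by (simp add: ek)
    then have "d (j + k * (p - 1) + k) = d k" for j .
    moreover have "j + k * (p - 1) + k = j + k * p" for j using k by (cases p) simp_all
    ultimately have "d j = d k" for j by (metis per_mult)
    then show False using nonconst by metis
  qed
  have "card (insert e ((\<lambda>k i. d (i + k)) ` {..<p})) \<le> card D"
    using shift_mem e(1) by (intro card_mono D) auto
  then show False
    using e_notin card_image[OF inj] D(2) by simp
qed

section \<open>Colorings of torus links by dihedral quandles\<close>

text \<open>Cyclic differences as a \<open>p\<close>-periodic sequence on all naturals, including
  the closing one from position \<open>p\<close> back to 1. Positions start at 1, hence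
  \<open>i mod p + 1\<close>.\<close>

definition coloring_differences :: "nat \<Rightarrow> nat \<Rightarrow> (nat \<Rightarrow> int) \<Rightarrow> nat \<Rightarrow> int" where
  "coloring_differences p n x i = (x (Suc i mod p + 1) - x (i mod p + 1)) mod int n"

text \<open>The translation part cancels in differences and the slope factors out; so translations
  preserve the differences and slope -1 negates them.\<close>

lemma coloring_differences_compose_affine:
  assumes "p > 0" "x \<in> {1..p} \<rightarrow> {0..<int n}"
  shows "coloring_differences p n (compose {1..p} (affine_map n b c) x) i =
    (c * coloring_differences p n x i) mod int n"
proof -
  have mem: "k mod p + 1 \<in> {1..p}" for k using assms(1) by (simp add: Suc_leI)
  have x_val: "compose {1..p} (affine_map n b c) x (k mod p + 1) = (b + c * x (k mod p + 1)) mod int n" for k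
    using mem[of k] Pi_mem[OF assms(2) mem[of k]] by (simp add: compose_def affine_map_def)
  have "coloring_differences p n (compose {1..p} (affine_map n b c) x) i =
      ((b + c * x (Suc i mod p + 1)) - (b + c * x (i mod p + 1))) mod int n"
    unfolding coloring_differences_def x_val by (rule mod_diff_eq)
  also have "\<dots> = (c * (x (Suc i mod p + 1) - x (i mod p + 1))) mod int n"
    by (simp add: algebra_simps)
  also have "\<dots> = (c * coloring_differences p n x i) mod int n"
    unfolding coloring_differences_def by (rule mod_mult_right_eq[symmetric])
  finally show ?thesis .
qed

text \<open>The last entry \<open>x 1\<close> is \<open>2 * x 1 - x 1\<close>, so with cyclic
  indices the row action has the form \<open>2 * x 1 - x (j + 1)\<close> throughout. Taking
  differences leaves a shift and a sign.\<close>

lemma coloring_differences_row_act: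
  assumes p: "p > 0" and x: "x \<in> {1..p} \<rightarrow> {0..<int n}"
  shows "coloring_differences p n (restrict (row_act (dihedral_quandle n) p x) {1..p}) i =
    (- coloring_differences p n x (Suc i)) mod int n"
proof -
  let ?T = "restrict (row_act (dihedral_quandle n) p x) {1..p}"
  have T: "?T (k mod p + 1) = (2 * x 1 - x (Suc k mod p + 1)) mod int n" for k
  proof (cases "Suc (k mod p) = p")
    case True
    have "x 1 \<in> {0..<int n}" using p by (intro Pi_mem[OF x]) simp
    then show ?thesis using True p by (simp add: row_act_def mod_Suc)
  next
    case False
    then have "Suc (k mod p) < p" using p by (simp add: le_neq_implies_less Suc_leI)
    then show ?thesis using False by (simp add: row_act_def mod_Suc)
  qed
  have "coloring_differences p n ?T i =
      ((2 * x 1 - x (Suc (Suc i) mod p + 1)) - (2 * x 1 - x (Suc i mod p + 1))) mod int n"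
    unfolding coloring_differences_def T by (rule mod_diff_eq)
  also have "\<dots> = (- (x (Suc (Suc i) mod p + 1) - x (Suc i mod p + 1))) mod int n"
    by (simp add: algebra_simps)
  also have "\<dots> = (- coloring_differences p n x (Suc i)) mod int n"
    unfolding coloring_differences_def by (rule mod_minus_eq[symmetric])
  finally show ?thesis .
qed

text \<open>Telescoping around the cycle. The index \<open>i\<close> may exceed \<open>p\<close>;
  taking \<open>i = p\<close> gives the closing condition.\<close>

lemma coloring_eq_sum_differences:
  assumes p: "p > 0" and x: "x \<in> {1..p} \<rightarrow> {0..<int n}"
    and const: "\<And>i. coloring_differences p n x i = a"
  shows "x (i mod p + 1) = (x 1 + int i * a) mod int n"
proof (induction i)
  case 0
  have "x 1 \<in> {0..<int n}" using p by (intro Pi_mem[OF x]) simp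
  then show ?case by simp
next
  case (Suc i)
  have mem: "x (Suc i mod p + 1) \<in> {0..<int n}"
    using p by (intro Pi_mem[OF x]) (simp add: Suc_leI)
  then have "x (Suc i mod p + 1) = (x (i mod p + 1) + (x (Suc i mod p + 1) - x (i mod p + 1))) mod int n"
    by simp
  also have "\<dots> = (x (i mod p + 1) + a) mod int n"
    using const[of i] unfolding coloring_differences_def by (metis mod_add_right_eq)
  also have "\<dots> = (x 1 + int i * a + a) mod int n"
    unfolding Suc by (rule mod_add_left_eq)
  also have "x 1 + int i * a + a = x 1 + int (Suc i) * a" by (simp add: algebra_simps)
  finally show ?case .
qed

text \<open>From the first entry on, the differences fix each next entry modulo \<open>n\<close>,
  and reduced representatives turn congruence into equality.\<close>

lemma coloring_eqI:
  assumes x: "x \<in> {1..p} \<rightarrow>\<^sub>E {0..<int n}" and y: "y \<in> {1..p} \<rightarrow>\<^sub>E {0..<int n}"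
    and base: "x 1 = y 1" and diff: "coloring_differences p n x = coloring_differences p n y"
  shows "x = y"
proof (rule PiE_ext[OF x y])
  have "i < p \<Longrightarrow> x (Suc i) = y (Suc i)" for i
  proof (induction i)
    case (Suc i)
    have "(x (Suc (Suc i)) - x (Suc i)) mod int n = (y (Suc (Suc i)) - y (Suc i)) mod int n"
      using fun_cong[OF diff, of i] Suc.prems by (simp add: coloring_differences_def)
    then have "x (Suc (Suc i)) mod int n = y (Suc (Suc i)) mod int n"
      using Suc by (simp add: mod_eq_dvd_iff)
    moreover have "x (Suc (Suc i)) \<in> {0..<int n}" "y (Suc (Suc i)) \<in> {0..<int n}"
      using PiE_mem[OF x, of "Suc (Suc i)"] PiE_mem[OF y, of "Suc (Suc i)"] Suc.prems by simp_all
    ultimately show ?case by simp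
  qed (simp add: base[unfolded One_nat_def])
  then show "x j = y j" if "j \<in> {1..p}" for j
    using that by (cases j) simp_all
qed

lemma finite_torus_colorings:
  "finite (torus_colorings p q (dihedral_quandle n))"
  by (rule finite_subset[of _ "{1..p} \<rightarrow>\<^sub>E {0..<int n}"])
    (auto simp: torus_colorings_def intro: finite_PiE)

text \<open>Translations act freely on the colorings and preserve the differences.\<close>

lemma card_torus_colorings:
  fixes p q n :: nat
  assumes p: "p > 0" and n: "n > 0"
  defines "S \<equiv> torus_colorings p q (dihedral_quandle n)"
  shows "card S = n * card (coloring_differences p n ` S)"
proof -
  have S: "x \<in> {1..p} \<rightarrow>\<^sub>E {0..<int n}" if "x \<in> S" for x
    using that by (simp add: S_def torus_colorings_def)
  have S1: "x 1 \<in> {0..<int n}" if "x \<in> S" for x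
    using PiE_mem[OF S[OF that], of 1] p by simp
  have "bij_betw (\<lambda>x. (x 1, coloring_differences p n x)) S
      ({0..<int n} \<times> coloring_differences p n ` S)"
  proof (rule bij_betw_imageI)
    show "inj_on (\<lambda>x. (x 1, coloring_differences p n x)) S"
    proof (rule inj_onI)
      fix x y assume xy: "x \<in> S" "y \<in> S"
        and eq: "(x 1, coloring_differences p n x) = (y 1, coloring_differences p n y)"
      show "x = y" by (rule coloring_eqI[OF S[OF xy(1)] S[OF xy(2)]]) (use eq in simp_all)
    qed
    show "(\<lambda>x. (x 1, coloring_differences p n x)) ` S =
        {0..<int n} \<times> coloring_differences p n ` S"
    proof (intro equalityI subsetI)
      fix z assume "z \<in> {0..<int n} \<times> coloring_differences p n ` S"
      then obtain b x where z: "z = (b, coloring_differences p n x)" "b \<in> {0..<int n}" "x \<in> S"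
        by blast
      \<comment> \<open>Translation by \<open>b - x 1\<close> moves the first entry to
        \<open>b\<close> and keeps the differences.\<close>
      let ?y = "compose {1..p} (affine_map n (b - x 1) 1) x"
      have "?y \<in> S"
        unfolding S_def using z(3) S_def
        by (intro torus_colorings_compose[OF quandle_dihedral[OF n] p] affine_map_in_quandle_hom n) simp
      moreover have "?y 1 = b"
        using S1[OF z(3)] z(2) p by (simp add: compose_def affine_map_def)
      moreover have "coloring_differences p n ?y = coloring_differences p n x"
      proof
        fix i
        have "x \<in> {1..p} \<rightarrow> {0..<int n}" using S[OF z(3)] unfolding PiE_def by blast
        then show "coloring_differences p n ?y i = coloring_differences p n x i"
          by (subst coloring_differences_compose_affine[OF p]) (simp_all add: coloring_differences_def)
      qed
      ultimately show "z \<in> (\<lambda>x. (x 1, coloring_differences p n x)) ` S"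
        unfolding z(1) by (intro image_eqI[of _ _ ?y]) simp_all
    next
      fix z assume "z \<in> (\<lambda>x. (x 1, coloring_differences p n x)) ` S"
      then show "z \<in> {0..<int n} \<times> coloring_differences p n ` S" using S1 by blast
    qed
  qed
  then show ?thesis by (simp add: bij_betw_same_card card_cartesian_product)
qed

section \<open>Colorings that are arithmetic progressions\<close>

text \<open>The step is a multiple of \<open>n div p\<close> so that, when \<open>p\<close> divides
  \<open>n\<close>, the progression closes up modulo \<open>n\<close> after \<open>p\<close>
  steps.\<close>

definition arithmetic_coloring :: "nat \<Rightarrow> nat \<Rightarrow> int \<Rightarrow> int \<Rightarrow> nat \<Rightarrow> int" where
  "arithmetic_coloring p n b k = (\<lambda>j\<in>{1..p}. (b + (int j - 1) * (k * int (n div p))) mod int n)"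

text \<open>Dividing out translations leaves exactly \<open>p\<close> difference sequences. They
  have period \<open>p\<close>, are closed under the shift and include a constant one, so primality
  forces all of them to be constant.\<close>

lemma coloring_differences_constant:
  assumes p: "prime p" and n: "n > 0"
    and card: "card (torus_colorings p q (dihedral_quandle n)) = p * n"
    and x: "x \<in> torus_colorings p q (dihedral_quandle n)"
  shows "coloring_differences p n x i = coloring_differences p n x 0"
proof -
  define S where "S = torus_colorings p q (dihedral_quandle n)"
  have p0: "p > 0" using p by (rule prime_gt_0_nat)
  have X: "quandle (dihedral_quandle n)" using n by (rule quandle_dihedral)
  have S: "y \<in> {1..p} \<rightarrow> {0..<int n}" if "y \<in> S" for y
    using that by (auto simp: S_def torus_colorings_def)
  have compose_mem: "compose {1..p} (affine_map n b c) y \<in> S" if "y \<in> S" for b c y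
    using that unfolding S_def
    by (intro torus_colorings_compose[OF X p0] affine_map_in_quandle_hom n)
  show ?thesis
  proof (rule constant_if_shift_closed[OF p, of "coloring_differences p n ` S"])
    show "finite (coloring_differences p n ` S)"
      unfolding S_def by (intro finite_imageI finite_torus_colorings)
    show "card (coloring_differences p n ` S) = p"
      using card_torus_colorings[OF p0 n, of q] card n by (simp add: S_def)
    show "d (i + p) = d i" if "d \<in> coloring_differences p n ` S" for d i
    proof -
      have "Suc (i + p) mod p = Suc i mod p" using mod_add_self2[of "Suc i" p] by simp
      then show ?thesis using that by (auto simp: coloring_differences_def)
    qed
    show "(\<lambda>i. d (Suc i)) \<in> coloring_differences p n ` S"
      if "d \<in> coloring_differences p n ` S" for d
    proof -
      from that obtain y where y: "y \<in> S" "d = coloring_differences p n y" by blast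
      \<comment> \<open>The row action shifts and negates the differences; the endomorphism of slope
        -1 removes the sign.\<close>
      let ?T = "restrict (row_act (dihedral_quandle n) p y) {1..p}"
      have T: "?T \<in> S" using torus_colorings_row_act[OF X p0] y(1) by (simp add: S_def)
      have "coloring_differences p n (compose {1..p} (affine_map n 0 (-1)) ?T) i = d (Suc i)" for i
      proof -
        have "coloring_differences p n (compose {1..p} (affine_map n 0 (-1)) ?T) i =
            (- ((- d (Suc i)) mod int n)) mod int n"
          unfolding coloring_differences_compose_affine[OF p0 S[OF T]]
            coloring_differences_row_act[OF p0 S[OF y(1)]] y(2) by simp
        also have "\<dots> = d (Suc i) mod int n" by (simp add: mod_minus_eq)
        also have "\<dots> = d (Suc i)" by (simp add: y(2) coloring_differences_def)
        finally show ?thesis .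
      qed
      then have "(\<lambda>i. d (Suc i)) = coloring_differences p n (compose {1..p} (affine_map n 0 (-1)) ?T)"
        by auto
      then show ?thesis using compose_mem[OF T] by blast
    qed
    have xS: "x \<in> S" using x by (simp add: S_def)
    \<comment> \<open>The constant member is the difference sequence of the zero coloring, the image
      of \<open>x\<close> under the zero map.\<close>
    show "coloring_differences p n (compose {1..p} (affine_map n 0 0) x) \<in> coloring_differences p n ` S"
      using compose_mem[OF xS] by blast
    show "coloring_differences p n (compose {1..p} (affine_map n 0 0) x) (Suc i) =
        coloring_differences p n (compose {1..p} (affine_map n 0 0) x) i" for i
      unfolding coloring_differences_compose_affine[OF p0 S[OF xS]] by simp
    show "coloring_differences p n x \<in> coloring_differences p n ` S" using xS by blast
  qed
qed

text \<open>A constant difference \<open>a\<close> closes up after \<open>p\<close> steps, so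
  \<open>n\<close> divides \<open>p * a\<close>. If \<open>p\<close> did not divide
  \<open>n\<close>, only \<open>a = 0\<close> would remain, against \<open>p > 1\<close> difference
  sequences. Hence \<open>p\<close> divides \<open>n\<close>, and \<open>a\<close> is a multiple of
  \<open>n div p\<close>.\<close>

lemma torus_colorings_arithmetic:
  assumes p: "prime p" and n: "n > 0"
    and card: "card (torus_colorings p q (dihedral_quandle n)) = p * n"
  shows "p dvd n"
    and "bij_betw (case_prod (arithmetic_coloring p n)) ({0..<int n} \<times> {0..<int p})
      (torus_colorings p q (dihedral_quandle n))"
proof -
  define S where "S = torus_colorings p q (dihedral_quandle n)"
  define D where "D = coloring_differences p n ` S"
  have p0: "p > 0" using p by (rule prime_gt_0_nat)
  have S: "y \<in> {1..p} \<rightarrow>\<^sub>E {0..<int n}" if "y \<in> S" for y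
    using that by (auto simp: S_def torus_colorings_def)
  have S': "y \<in> {1..p} \<rightarrow> {0..<int n}" if "y \<in> S" for y
    using S[OF that] by auto
  have const: "coloring_differences p n x i = coloring_differences p n x 0" if "x \<in> S" for x i
    by (rule coloring_differences_constant[OF p n card that[unfolded S_def]])
  have a_range: "coloring_differences p n x 0 \<in> {0..<int n}" for x
    using n by (simp add: coloring_differences_def)
  have a_dvd: "int n dvd int p * coloring_differences p n x 0" if x: "x \<in> S" for x
  proof -
    have "x 1 = (x 1 + int p * coloring_differences p n x 0) mod int n"
      using coloring_eq_sum_differences[OF p0 S'[OF x] const[OF x], of p] by simp
    moreover have "x 1 mod int n = x 1"
      using PiE_mem[OF S[OF x], of 1] p0 by simp
    ultimately have "(x 1 + int p * coloring_differences p n x 0) mod int n = x 1 mod int n" by simp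
    then show ?thesis by (simp add: mod_eq_dvd_iff)
  qed
  show "p dvd n"
  proof (rule ccontr)
    assume "\<not> p dvd n"
    then have "coprime (int n) (int p)"
      using prime_imp_coprime[OF p] by (simp add: coprime_commute)
    have "d = (\<lambda>_. 0)" if "d \<in> D" for d
    proof -
      obtain x where x: "x \<in> S" "d = coloring_differences p n x"
        using \<open>d \<in> D\<close> unfolding D_def by blast
      have "int n dvd coloring_differences p n x 0"
        using a_dvd[OF x(1)] \<open>coprime (int n) (int p)\<close> by (simp add: coprime_dvd_mult_right_iff)
      then have "coloring_differences p n x 0 = 0"
        using a_range[of x] by (auto dest: zdvd_imp_le)
      then have "d i = 0" for i unfolding x(2) const[OF x(1), of i] .
      then show ?thesis by (rule ext)
    qed
    then have "D \<subseteq> {\<lambda>_. 0}" by blast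
    then have "card D \<le> 1" using card_mono[of "{\<lambda>_. 0 :: int}" D] by simp
    moreover have "card D = p"
      using card_torus_colorings[OF p0 n, of q] card n by (simp add: S_def D_def)
    ultimately show False using prime_gt_1_nat[OF p] by simp
  qed
  then obtain m where m: "n = p * m" by (rule dvdE)
  have m_div: "n div p = m" using m p0 by simp
  let ?P = "{0..<int n} \<times> {0..<int p}"
  have sub: "S \<subseteq> case_prod (arithmetic_coloring p n) ` ?P"
  proof
    fix x assume x: "x \<in> S"
    let ?a = "coloring_differences p n x 0"
    have "int m dvd ?a" using a_dvd[OF x] p0 by (simp add: m)
    then obtain k where k: "?a = int m * k" by (rule dvdE)
    have m0: "int m > 0" using n by (simp add: m)
    have "0 \<le> int m * k" "int m * k < int n"
      using a_range[of x] unfolding k by simp_all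
    then have "0 \<le> int m * k" "int m * k < int m * int p"
      by (simp_all only: m of_nat_mult mult.commute)
    then have k_mem: "k \<in> {0..<int p}"
      using m0 by (simp add: zero_le_mult_iff mult_less_cancel_left_pos)
    have "x j = arithmetic_coloring p n (x 1) k j" if j: "j \<in> {1..p}" for j
    proof -
      have "x ((j - 1) mod p + 1) = (x 1 + int (j - 1) * ?a) mod int n"
        by (rule coloring_eq_sum_differences[OF p0 S'[OF x] const[OF x]])
      moreover have "(j - 1) mod p + 1 = j" using j by auto
      moreover have "int (j - 1) = int j - 1" using j by (simp add: of_nat_diff)
      ultimately show ?thesis using j by (simp add: arithmetic_coloring_def m_div k mult.commute)
    qed
    moreover have "x \<in> extensional {1..p}" "arithmetic_coloring p n (x 1) k \<in> extensional {1..p}"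
      using S[OF x] by (simp_all only: PiE_iff arithmetic_coloring_def restrict_extensional)
    ultimately have "x = arithmetic_coloring p n (x 1) k"
      by (intro extensionalityI[of x "{1..p}"])
    moreover have "x 1 \<in> {0..<int n}" using PiE_mem[OF S[OF x], of 1] p0 by simp
    ultimately show "x \<in> case_prod (arithmetic_coloring p n) ` ?P"
      using k_mem by (intro image_eqI[of _ _ "(x 1, k)"]) simp_all
  qed
  \<comment> \<open>There are as many parameters as colorings, and every coloring is in the image.
    Counting thus yields both that each progression is a coloring and that the parametrization is
    injective.\<close>
  have card_P: "card ?P = card S" using card by (simp add: S_def card_cartesian_product)
  have "card (case_prod (arithmetic_coloring p n) ` ?P) \<le> card S"
    unfolding card_P[symmetric] by (rule card_image_le) simp
  then have S_eq: "S = case_prod (arithmetic_coloring p n) ` ?P"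
    by (intro card_seteq sub) simp_all
  moreover have "inj_on (case_prod (arithmetic_coloring p n)) ?P"
    by (rule eq_card_imp_inj_on) (use S_eq card_P in simp_all)
  ultimately show "bij_betw (case_prod (arithmetic_coloring p n)) ?P
      (torus_colorings p q (dihedral_quandle n))"
    by (simp add: bij_betw_def S_def)
qed

section \<open>Endomorphisms acting on arithmetic colorings\<close>

text \<open>The start is moved by the affine map and the step is multiplied by \<open>c\<close>.
  With \<open>n = p * m\<close>, a step \<open>k * m\<close> modulo \<open>n\<close> depends only on
  \<open>k\<close> modulo \<open>p\<close>.\<close>

lemma compose_affine_arithmetic_coloring:
  assumes "p dvd n" "n > 0"
  shows "compose {1..p} (affine_map n b c) (arithmetic_coloring p n b' k) =
    arithmetic_coloring p n ((b + c * b') mod int n) (c * k mod int p)"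
proof (rule ext)
  fix j
  obtain m where m: "n = p * m" using assms(1) by (rule dvdE)
  have p0: "p > 0" using assms(2) by (simp add: m)
  show "compose {1..p} (affine_map n b c) (arithmetic_coloring p n b' k) j =
      arithmetic_coloring p n ((b + c * b') mod int n) (c * k mod int p) j"
  proof (cases "j \<in> {1..p}")
    case True
    let ?i = "int j - 1"
    have red: "(c * k mod int p) * int m = (c * k * int m) mod int n"
      by (simp add: m mult_mod_left)
    have "compose {1..p} (affine_map n b c) (arithmetic_coloring p n b' k) j =
        (b + c * ((b' + ?i * (k * int m)) mod int n)) mod int n"
      using True p0 assms(2) by (simp add: compose_def affine_map_def arithmetic_coloring_def m)
    also have "\<dots> = (b + c * (b' + ?i * (k * int m))) mod int n"
      by (intro mod_add_cong mod_mult_cong) simp_all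
    also have "b + c * (b' + ?i * (k * int m)) = (b + c * b') + ?i * (c * k * int m)"
      by (simp add: algebra_simps)
    also have "\<dots> mod int n = ((b + c * b') mod int n + ?i * ((c * k * int m) mod int n)) mod int n"
      by (intro mod_add_cong mod_mult_cong) simp_all
    also have "\<dots> = arithmetic_coloring p n ((b + c * b') mod int n) (c * k mod int p) j"
      using True p0 unfolding red[symmetric] by (simp add: arithmetic_coloring_def m)
    finally show ?thesis .
  next
    case False
    then show ?thesis
      by (simp only: compose_def arithmetic_coloring_def restrict_def if_False)
  qed
qed

text \<open>\<open>k\<close> is invertible modulo the prime \<open>p\<close>, so the condition
  selects one residue class modulo \<open>p\<close>, which meets \<open>{0..<int n}\<close> in
  \<open>n div p\<close> points.\<close>

lemma card_mult_mod_eq: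
  assumes p: "prime p" and n: "p dvd n" and k: "k \<in> {1..<int p}" and l: "l \<in> {0..<int p}"
  shows "card {c \<in> {0..<int n}. c * k mod int p = l} = n div p"
proof -
  have p0: "p > 0" using p by (rule prime_gt_0_nat)
  obtain m where m: "n = p * m" using n by (rule dvdE)
  have inj: "c = c'" if "c \<in> {0..<int p}" "c' \<in> {0..<int p}" "c * k mod int p = c' * k mod int p" for c c'
  proof -
    have "int p dvd (c - c') * k" using that(3) by (simp add: mod_eq_dvd_iff left_diff_distrib)
    moreover have "\<not> int p dvd k" using k by (auto dest: zdvd_imp_le)
    ultimately have "int p dvd c - c'" using p by (simp add: prime_dvd_mult_iff)
    then have "c mod int p = c' mod int p" by (simp add: mod_eq_dvd_iff)
    then show ?thesis using that by simp
  qed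
  \<comment> \<open>An injective self-map of a finite set is onto, which supplies a solution
    \<open>c0\<close> without computing an inverse of \<open>k\<close>.\<close>
  have "inj_on (\<lambda>c. c * k mod int p) {0..<int p}"
    by (rule inj_onI) (rule inj)
  then have "(\<lambda>c. c * k mod int p) ` {0..<int p} = {0..<int p}"
    using p0 by (intro endo_inj_surj) auto
  then have "l \<in> (\<lambda>c. c * k mod int p) ` {0..<int p}" using l by simp
  then obtain c0 where c0: "c0 \<in> {0..<int p}" "c0 * k mod int p = l" by blast
  have "{c \<in> {0..<int n}. c * k mod int p = l} = (\<lambda>t. c0 + int p * t) ` {0..<int m}"
  proof (intro equalityI subsetI)
    fix c assume c: "c \<in> {c \<in> {0..<int n}. c * k mod int p = l}"
    have "(c mod int p) * k mod int p = c * k mod int p" by (rule mod_mult_left_eq)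
    then have "c mod int p = c0" using c c0 p0 by (intro inj[of "c mod int p" c0]) simp_all
    then have c_eq: "c = c0 + int p * (c div int p)" by (metis add.commute mult_div_mod_eq)
    have "int p * (c div int p) \<le> c" using c_eq c0(1) by simp
    also have "c < int p * int m" using c by (simp add: m)
    finally have "int p * (c div int p) < int p * int m" .
    then have "c div int p < int m" using p0 by simp
    moreover have "0 \<le> c div int p" using c p0 by (simp add: pos_imp_zdiv_nonneg_iff)
    ultimately show "c \<in> (\<lambda>t. c0 + int p * t) ` {0..<int m}"
      using c_eq by (intro image_eqI[of _ _ "c div int p"]) simp_all
  next
    fix c assume "c \<in> (\<lambda>t. c0 + int p * t) ` {0..<int m}"
    then obtain t where t: "c = c0 + int p * t" "0 \<le> t" "t \<le> int m - 1" by fastforce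
    have "c * k mod int p = l"
      unfolding t(1) c0(2)[symmetric] by (intro mod_mult_cong) simp_all
    \<comment> \<open>The bound by \<open>int m - 1\<close> leaves room for
      \<open>c0 < int p\<close> below \<open>int n\<close>.\<close>
    moreover have "int p * t \<le> int p * (int m - 1)" using t(3) by (intro mult_left_mono) simp_all
    then have "c < int n" using c0(1) by (simp add: t(1) m algebra_simps)
    moreover have "0 \<le> c" using c0(1) t by simp
    ultimately show "c \<in> {c \<in> {0..<int n}. c * k mod int p = l}" by simp
  qed
  moreover have "inj_on (\<lambda>t. c0 + int p * t) {0..<int m}" using p0 by (simp add: inj_on_def)
  ultimately show ?thesis using p0 by (simp add: card_image m)
qed

text \<open>For each slope \<open>c\<close> that carries the step \<open>k\<close> to
  \<open>k'\<close>, exactly one translation part, \<open>b' - c * b\<close> modulo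
  \<open>n\<close>, carries \<open>b\<close> to \<open>b'\<close>. The count therefore depends on
  the slopes alone.\<close>

lemma card_endomorphisms_between_arithmetic_colorings:
  assumes n: "n > 0" and p: "p dvd n"
    and inj: "inj_on (case_prod (arithmetic_coloring p n)) ({0..<int n} \<times> {0..<int p})"
    and b: "b' \<in> {0..<int n}" and k: "k' \<in> {0..<int p}"
  shows "card {f \<in> quandle_hom (dihedral_quandle n) (dihedral_quandle n).
      compose {1..p} f (arithmetic_coloring p n b k) = arithmetic_coloring p n b' k'} =
    card {c \<in> {0..<int n}. c * k mod int p = k'}"
proof -
  let ?C = "{c \<in> {0..<int n}. c * k mod int p = k'}"
  let ?E = "{f \<in> quandle_hom (dihedral_quandle n) (dihedral_quandle n).
      compose {1..p} f (arithmetic_coloring p n b k) = arithmetic_coloring p n b' k'}"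
  let ?g = "\<lambda>c. ((b' - c * b) mod int n, c)"
  have p0: "p > 0" using n p by (auto intro: Nat.gr0I)
  have solve: "(e + c * b) mod int n = b' \<longleftrightarrow> e = (b' - c * b) mod int n" if "e \<in> {0..<int n}" for e c
  proof
    assume "(e + c * b) mod int n = b'"
    then have "(b' - c * b) mod int n = (e + c * b - c * b) mod int n"
      by (metis mod_diff_left_eq)
    then show "e = (b' - c * b) mod int n" using that by simp
  next
    assume "e = (b' - c * b) mod int n"
    then have "(e + c * b) mod int n = (b' - c * b + c * b) mod int n"
      by (metis mod_add_left_eq)
    then show "(e + c * b) mod int n = b'" using b by simp
  qed
  have col_eq: "compose {1..p} (affine_map n e c) (arithmetic_coloring p n b k) =
      arithmetic_coloring p n b' k' \<longleftrightarrow> (e + c * b) mod int n = b' \<and> c * k mod int p = k'" for e c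
    unfolding compose_affine_arithmetic_coloring[OF p n]
    using inj_on_eq_iff[OF inj, of "((e + c * b) mod int n, c * k mod int p)" "(b', k')"] b k n p0
    by simp
  have "?E = case_prod (affine_map n) ` (?g ` ?C)"
  proof (intro equalityI subsetI)
    fix f assume f: "f \<in> ?E"
    then obtain e c where ec: "e \<in> {0..<int n}" "c \<in> {0..<int n}" "f = affine_map n e c"
      unfolding quandle_hom_dihedral[OF n] by auto
    then have "(e, c) = ?g c" "c \<in> ?C" using f col_eq solve[OF ec(1)] by simp_all
    then show "f \<in> case_prod (affine_map n) ` (?g ` ?C)" using ec(3) by force
  next
    fix f assume "f \<in> case_prod (affine_map n) ` (?g ` ?C)"
    then obtain c where c: "c \<in> ?C" "f = affine_map n ((b' - c * b) mod int n) c" by auto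
    have "compose {1..p} f (arithmetic_coloring p n b k) = arithmetic_coloring p n b' k'"
      using c solve[of "(b' - c * b) mod int n" c] n by (simp only: col_eq) simp
    then show "f \<in> ?E" using c(2) affine_map_in_quandle_hom[OF n] by simp
  qed
  moreover have "inj_on (case_prod (affine_map n)) (?g ` ?C)"
    using n by (intro inj_on_subset[OF inj_on_affine_map]) auto
  moreover have "inj_on ?g ?C" by (simp add: inj_on_def)
  ultimately show ?thesis by (simp only: card_image)
qed

section \<open>Digraphs determined by their edge multiplicities\<close>

text \<open>Equal multiplicities give a bijection of edge sets over each ordered pair of vertices;
  since an edge determines its endpoints, these glue to one bijection of all edges.\<close>

lemma digraph_iso_of_multiplicities:
  assumes wf: "wf_digraph G" "wf_digraph H" and fin: "finite (arcs G)" "finite (arcs H)"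
    and h: "bij_betw h (verts G) (verts H)"
    and mult: "\<And>u v. u \<in> verts G \<Longrightarrow> v \<in> verts G \<Longrightarrow>
      card {e \<in> arcs G. tail G e = u \<and> head G e = v} =
      card {e \<in> arcs H. tail H e = h u \<and> head H e = h v}"
  shows "digraph_iso G H"
proof -
  interpret G: wf_digraph G by fact
  interpret H: wf_digraph H by fact
  let ?EG = "\<lambda>u v. {e \<in> arcs G. tail G e = u \<and> head G e = v}"
  let ?EH = "\<lambda>u v. {e \<in> arcs H. tail H e = u \<and> head H e = v}"
  define b where "b u v = (SOME f. bij_betw f (?EG u v) (?EH (h u) (h v)))" for u v
  have b: "bij_betw (b u v) (?EG u v) (?EH (h u) (h v))" if "u \<in> verts G" "v \<in> verts G" for u v
  proof -
    have "\<exists>f. bij_betw f (?EG u v) (?EH (h u) (h v))"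
      using fin mult[OF that] by (intro finite_same_card_bij) simp_all
    then show ?thesis unfolding b_def by (rule someI_ex)
  qed
  define k where "k e = b (tail G e) (head G e) e" for e
  have k: "k e \<in> arcs H \<and> tail H (k e) = h (tail G e) \<and> head H (k e) = h (head G e)"
    if "e \<in> arcs G" for e
  proof -
    have "bij_betw (b (tail G e) (head G e)) (?EG (tail G e) (head G e))
        (?EH (h (tail G e)) (h (head G e)))"
      using that by (intro b) simp_all
    from bij_betwE[OF this, rule_format, of e] show ?thesis using that by (simp add: k_def)
  qed
  have h_inj: "inj_on h (verts G)" and h_im: "h ` verts G = verts H"
    using h by (simp_all add: bij_betw_def)
  have "inj_on k (arcs G)"
  proof (rule inj_onI)
    fix e e' assume e: "e \<in> arcs G" "e' \<in> arcs G" and eq: "k e = k e'"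
    then have "h (tail G e) = h (tail G e')" "h (head G e) = h (head G e')"
      using k[OF e(1)] k[OF e(2)] by simp_all
    then have ends: "tail G e' = tail G e" "head G e' = head G e"
      using inj_onD[OF h_inj] e by simp_all
    have "inj_on (b (tail G e) (head G e)) (?EG (tail G e) (head G e))"
      using e by (intro bij_betw_imp_inj_on[OF b]) simp_all
    then show "e = e'"
      by (rule inj_onD) (use e eq ends in \<open>simp_all add: k_def\<close>)
  qed
  moreover have "arcs H \<subseteq> k ` arcs G"
  proof
    fix e assume e: "e \<in> arcs H"
    then obtain u v where uv: "u \<in> verts G" "v \<in> verts G" "tail H e = h u" "head H e = h v"
      using h_im H.tail_in_verts[OF e] H.head_in_verts[OF e] by (metis imageE)
    then have "e \<in> b u v ` ?EG u v"
      using bij_betw_imp_surj_on[OF b[OF uv(1,2)]] e by simp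
    then show "e \<in> k ` arcs G" by (auto simp: k_def)
  qed
  moreover have "k ` arcs G \<subseteq> arcs H" using k by blast
  ultimately have k_bij: "inj_on k (arcs G)" "k ` arcs G = arcs H" by blast+
  \<comment> \<open>The isomorphism record carries the endpoint functions of the image; taking those
    of \<open>H\<close> makes the image equal to \<open>H\<close> as a record.\<close>
  let ?iso = "\<lparr>iso_verts = h, iso_arcs = k, iso_head = head H, iso_tail = tail H\<rparr>"
  have "pre_digraph.digraph_isomorphism G ?iso"
    unfolding pre_digraph.digraph_isomorphism_def using wf(1) h_inj k_bij(1) k by simp
  moreover have "H = app_iso ?iso G"
    by (simp add: app_iso_def h_im k_bij(2))
  ultimately show ?thesis unfolding digraph_iso_def by blast
qed

lemma card_arcs_join_complete:
  fixes d k l m m' :: nat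
  defines "H \<equiv> digraph_join d (complete_multidigraph m k) (complete_multidigraph m' l)"
  shows "i < m \<Longrightarrow> j < m \<Longrightarrow> card {e \<in> arcs H. tail H e = Inl i \<and> head H e = Inl j} = k"
    and "i < m \<Longrightarrow> j < m' \<Longrightarrow> card {e \<in> arcs H. tail H e = Inl i \<and> head H e = Inr j} = 0"
    and "i < m' \<Longrightarrow> j < m \<Longrightarrow> card {e \<in> arcs H. tail H e = Inr i \<and> head H e = Inl j} = d"
    and "i < m' \<Longrightarrow> j < m' \<Longrightarrow> card {e \<in> arcs H. tail H e = Inr i \<and> head H e = Inr j} = l"
proof -
  have "{e \<in> arcs H. tail H e = Inl i \<and> head H e = Inl j} =
      (\<lambda>t. Inl (Inl (i, j, t))) ` {..<k}" if "i < m" "j < m"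
    using that by (auto simp: H_def digraph_join_def complete_multidigraph_def)
  then show "i < m \<Longrightarrow> j < m \<Longrightarrow> card {e \<in> arcs H. tail H e = Inl i \<and> head H e = Inl j} = k"
    by (simp add: card_image inj_on_def)
  have "{e \<in> arcs H. tail H e = Inl i \<and> head H e = Inr j} = {}"
    by (auto simp: H_def digraph_join_def complete_multidigraph_def)
  then show "i < m \<Longrightarrow> j < m' \<Longrightarrow> card {e \<in> arcs H. tail H e = Inl i \<and> head H e = Inr j} = 0"
    by (simp only: card.empty)
  have "{e \<in> arcs H. tail H e = Inr i \<and> head H e = Inl j} =
      (\<lambda>t. Inr (i, j, t)) ` {..<d}" if "i < m'" "j < m"
    using that by (auto simp: H_def digraph_join_def complete_multidigraph_def)
  then show "i < m' \<Longrightarrow> j < m \<Longrightarrow> card {e \<in> arcs H. tail H e = Inr i \<and> head H e = Inl j} = d"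
    by (simp add: card_image inj_on_def)
  have "{e \<in> arcs H. tail H e = Inr i \<and> head H e = Inr j} =
      (\<lambda>t. Inl (Inr (i, j, t))) ` {..<l}" if "i < m'" "j < m'"
    using that by (auto simp: H_def digraph_join_def complete_multidigraph_def)
  then show "i < m' \<Longrightarrow> j < m' \<Longrightarrow> card {e \<in> arcs H. tail H e = Inr i \<and> head H e = Inr j} = l"
    by (simp add: card_image inj_on_def)
qed

text \<open>Any enumerations of \<open>A\<close> and \<open>B\<close> serve as vertex map, since
  multiplicities depend only on the parts in which the endpoints lie.\<close>

lemma digraph_iso_join_complete:
  fixes d k l m m' :: nat
  assumes wf: "wf_digraph G" and fin: "finite (arcs G)"
    and V: "verts G = A \<union> B" "A \<inter> B = {}" "finite A" "finite B" "card A = m" "card B = m'"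
    and mult: "\<And>u v. u \<in> A \<Longrightarrow> v \<in> A \<Longrightarrow> card {e \<in> arcs G. tail G e = u \<and> head G e = v} = k"
      "\<And>u v. u \<in> A \<Longrightarrow> v \<in> B \<Longrightarrow> card {e \<in> arcs G. tail G e = u \<and> head G e = v} = 0"
      "\<And>u v. u \<in> B \<Longrightarrow> v \<in> A \<Longrightarrow> card {e \<in> arcs G. tail G e = u \<and> head G e = v} = d"
      "\<And>u v. u \<in> B \<Longrightarrow> v \<in> B \<Longrightarrow> card {e \<in> arcs G. tail G e = u \<and> head G e = v} = l"
  shows "digraph_iso G (digraph_join d (complete_multidigraph m k) (complete_multidigraph m' l))"
proof -
  let ?H = "digraph_join d (complete_multidigraph m k) (complete_multidigraph m' l)"
  obtain a where a: "bij_betw a A {..<m}"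
    using V finite_same_card_bij[of A "{..<m}"] by auto
  obtain b where b: "bij_betw b B {..<m'}"
    using V finite_same_card_bij[of B "{..<m'}"] by auto
  define h where "h v = (if v \<in> A then Inl (a v) else Inr (b v))" for v
  have h_simps: "v \<in> A \<Longrightarrow> h v = Inl (a v)" "v \<in> B \<Longrightarrow> h v = Inr (b v)" for v
    using V(2) by (auto simp: h_def)
  have "inj_on h (A \<union> B)"
  proof (rule inj_onI)
    fix u v assume "u \<in> A \<union> B" "v \<in> A \<union> B" "h u = h v"
    then show "u = v"
      using inj_onD[OF bij_betw_imp_inj_on[OF a], of u v]
        inj_onD[OF bij_betw_imp_inj_on[OF b], of u v]
      by (elim UnE) (simp_all add: h_simps)
  qed
  moreover have "h ` A = Inl ` a ` A"
    unfolding image_image by (rule image_cong) (simp_all only: h_simps)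
  moreover have "h ` B = Inr ` b ` B"
    unfolding image_image by (rule image_cong) (simp_all only: h_simps)
  ultimately have h: "bij_betw h (verts G) (verts ?H)"
    using a b by (simp add: bij_betw_def V(1) image_Un digraph_join_def complete_multidigraph_def Plus_def)
  have lt: "v \<in> A \<Longrightarrow> a v < m" "v \<in> B \<Longrightarrow> b v < m'" for v
    using a b by (auto dest: bij_betwE)
  show ?thesis
  proof (rule digraph_iso_of_multiplicities[OF wf _ fin _ h])
    show "wf_digraph ?H" by unfold_locales (auto simp: digraph_join_def complete_multidigraph_def)
    show "finite (arcs ?H)" by (simp add: digraph_join_def complete_multidigraph_def)
    fix u v assume "u \<in> verts G" "v \<in> verts G"
    then consider "u \<in> A" "v \<in> A" | "u \<in> A" "v \<in> B" | "u \<in> B" "v \<in> A" | "u \<in> B" "v \<in> B"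
      unfolding V(1) by blast
    then show "card {e \<in> arcs G. tail G e = u \<and> head G e = v} =
        card {e \<in> arcs ?H. tail ?H e = h u \<and> head ?H e = h v}"
      by cases (simp_all only: h_simps mult card_arcs_join_complete lt)
  qed
qed

section \<open>The quiver of a torus link with \<open>p * n\<close> colorings\<close>

theorem theorem4p2:
  fixes p q n :: nat
  assumes "prime p" and "q > 0" and "n > 0"
    and "card (quandle_hom (fundamental_quandle (torus_link p q)) (dihedral_quandle n)) = p * n"
  shows "\<exists>d::nat. real d = real n / real p \<and>
    digraph_iso
      (full_quandle_coloring_quiver (torus_link p q) (dihedral_quandle n))
      (digraph_join d (complete_multidigraph n n) (complete_multidigraph ((p - 1) * n) d))"
proof -
  let ?X = "dihedral_quandle n" and ?Q = "fundamental_quandle (torus_link p q)"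
  let ?G = "full_quandle_coloring_quiver (torus_link p q) ?X"
  define H where "H = quandle_hom ?Q ?X"
  define \<rho> where "\<rho> f = (\<lambda>j\<in>{1..p}. f (bottom_class p q j))" for f :: "(nat \<times> nat) set qterm set \<Rightarrow> int"
  define col where "col = case_prod (arithmetic_coloring p n)"
  define P where "P = {0..<int n} \<times> {0..<int p}"
  have n: "n > 0" and p0: "p > 0" using assms(1,3) by (auto intro: prime_gt_0_nat)
  have X: "quandle ?X" using n by (rule quandle_dihedral)
  have \<rho>: "bij_betw \<rho> H (torus_colorings p q ?X)"
    unfolding \<rho>_def H_def by (rule bij_betw_torus_colorings[OF X p0])
  have "card (torus_colorings p q ?X) = p * n"
    using bij_betw_same_card[OF \<rho>] assms(4) by (simp add: H_def)
  note arith = torus_colorings_arithmetic[OF assms(1) n this]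
  have col: "bij_betw col P (torus_colorings p q ?X)"
    unfolding col_def P_def by (rule arith(2))
  \<comment> \<open>\<open>\<theta> (b, k)\<close> is the homomorphism whose bottom row is the
    progression with parameters \<open>b\<close> and \<open>k\<close>.\<close>
  define \<theta> where "\<theta> v = inv_into H \<rho> (col v)" for v
  have \<theta>: "bij_betw \<theta> P H"
    using bij_betw_trans[OF col bij_betw_inv_into[OF \<rho>]] by (simp add: \<theta>_def[abs_def] comp_def)
  have \<rho>_\<theta>: "\<rho> (\<theta> v) = col v" if "v \<in> P" for v
  proof -
    have "col v \<in> \<rho> ` H" using bij_betw_imp_surj_on[OF \<rho>] bij_betwE[OF col] that by blast
    then show ?thesis unfolding \<theta>_def by (rule f_inv_into_f)
  qed
  have \<theta>_mem: "\<theta> v \<in> H" if "v \<in> P" for v using bij_betwE[OF \<theta>] that by blast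
  have compose_mem: "compose (qcarrier ?Q) f g \<in> H"
    if "g \<in> H" "f \<in> quandle_hom ?X ?X" for f g
    using that unfolding H_def fundamental_quandle_def
    by (intro quandle_hom_compose[of _ _ ?X] qop_closed quandle_presented_quandle)
  \<comment> \<open>Post-composition commutes with reading the bottom row, so edges of the quiver
    can be counted on tuples.\<close>
  have \<rho>_compose: "\<rho> (compose (qcarrier ?Q) f g) = compose {1..p} f (\<rho> g)" for f g
    by (auto simp: \<rho>_def compose_def fun_eq_iff bottom_class_in_fundamental_quandle)
  have fin: "finite H" "finite (quandle_hom ?X ?X)"
    using bij_betw_finite[OF \<theta>] by (simp_all add: P_def quandle_hom_dihedral[OF n])
  have mult: "card {e \<in> arcs ?G. tail ?G e = \<theta> (b, k) \<and> head ?G e = \<theta> (b', k')} =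
      card {c \<in> {0..<int n}. c * k mod int p = k'}" if v: "(b, k) \<in> P" "(b', k') \<in> P" for b k b' k'
  proof -
    have "compose (qcarrier ?Q) f (\<theta> (b, k)) = \<theta> (b', k') \<longleftrightarrow>
        compose {1..p} f (arithmetic_coloring p n b k) = arithmetic_coloring p n b' k'"
      if "f \<in> quandle_hom ?X ?X" for f
      using inj_on_eq_iff[OF bij_betw_imp_inj_on[OF \<rho>] compose_mem[OF \<theta>_mem[OF v(1)] that] \<theta>_mem[OF v(2)]]
      by (simp add: \<rho>_compose \<rho>_\<theta>[OF v(1)] \<rho>_\<theta>[OF v(2)] col_def)
    then have "{e \<in> arcs ?G. tail ?G e = \<theta> (b, k) \<and> head ?G e = \<theta> (b', k')} =
        Pair (\<theta> (b, k)) ` {f \<in> quandle_hom ?X ?X.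
          compose {1..p} f (arithmetic_coloring p n b k) = arithmetic_coloring p n b' k'}"
      using \<theta>_mem[OF v(1)] by (auto simp: full_quandle_coloring_quiver_def H_def)
    then show ?thesis
      using card_endomorphisms_between_arithmetic_colorings[OF n arith(1)
          bij_betw_imp_inj_on[OF arith(2)], of b' k' b k] v(2)
      by (simp add: card_image inj_on_def P_def)
  qed
  \<comment> \<open>The parameter \<open>k = 0\<close> gives the constant colorings, the first
    summand of the join; nonzero \<open>k\<close> gives the second.\<close>
  let ?A = "\<theta> ` ({0..<int n} \<times> {0})" and ?B = "\<theta> ` ({0..<int n} \<times> {1..<int p})"
  have P_split: "P = {0..<int n} \<times> {0} \<union> {0..<int n} \<times> {1..<int p}"
    using p0 by (auto simp: P_def)
  have inj_\<theta>: "inj_on \<theta> P" using \<theta> by (rule bij_betw_imp_inj_on)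
  have "digraph_iso ?G (digraph_join (n div p) (complete_multidigraph n n)
      (complete_multidigraph ((p - 1) * n) (n div p)))"
  proof (rule digraph_iso_join_complete)
    show "wf_digraph ?G"
      by unfold_locales (auto simp: full_quandle_coloring_quiver_def compose_mem[unfolded H_def])
    show "finite (arcs ?G)" using fin by (simp add: full_quandle_coloring_quiver_def H_def)
    show "verts ?G = ?A \<union> ?B"
      using bij_betw_imp_surj_on[OF \<theta>]
      by (simp add: full_quandle_coloring_quiver_def H_def P_split image_Un)
    have "{0..<int n} \<times> {0} \<inter> {0..<int n} \<times> {1..<int p} = {}" by auto
    then show "?A \<inter> ?B = {}"
      using inj_on_image_Int[OF inj_\<theta>, of "{0..<int n} \<times> {0}" "{0..<int n} \<times> {1..<int p}"]
      by (simp only: P_split Un_upper1 Un_upper2 image_empty)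
    show "finite ?A" "finite ?B" by simp_all
    show "card ?A = n"
      using card_image[OF inj_on_subset[OF inj_\<theta>, of "{0..<int n} \<times> {0}"]]
      by (simp add: P_split card_cartesian_product)
    show "card ?B = (p - 1) * n"
      using card_image[OF inj_on_subset[OF inj_\<theta>, of "{0..<int n} \<times> {1..<int p}"]]
      by (simp add: P_split card_cartesian_product nat_diff_distrib')
  next
    fix u v assume "u \<in> ?A" "v \<in> ?A"
    then obtain b b' where uv: "u = \<theta> (b, 0)" "v = \<theta> (b', 0)" "b \<in> {0..<int n}" "b' \<in> {0..<int n}"
      by blast
    have bP: "(b, 0) \<in> P" "(b', 0) \<in> P" using uv(3,4) by (auto simp: P_split)
    \<comment> \<open>Every slope keeps the step 0, so each of the \<open>n\<close> slopes
      contributes one edge.\<close>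
    have "{c \<in> {0..<int n}. c * 0 mod int p = 0} = {0..<int n}" by auto
    then show "card {e \<in> arcs ?G. tail ?G e = u \<and> head ?G e = v} = n"
      unfolding uv(1,2) mult[OF bP] by (simp only: card_atLeastLessThan_int diff_zero nat_int)
  next
    fix u v assume "u \<in> ?A" "v \<in> ?B"
    then obtain b b' k' where uv: "u = \<theta> (b, 0)" "v = \<theta> (b', k')" "b \<in> {0..<int n}"
      "b' \<in> {0..<int n}" "k' \<in> {1..<int p}"
      by blast
    have bP: "(b, 0) \<in> P" "(b', k') \<in> P" using uv(3-5) by (auto simp: P_split)
    have "{c \<in> {0..<int n}. c * 0 mod int p = k'} = {}" using uv(5) by auto
    then show "card {e \<in> arcs ?G. tail ?G e = u \<and> head ?G e = v} = 0"
      unfolding uv(1,2) mult[OF bP] by (simp only: card.empty)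
  next
    fix u v assume "u \<in> ?B" "v \<in> ?A"
    then obtain b k b' where uv: "u = \<theta> (b, k)" "v = \<theta> (b', 0)" "b \<in> {0..<int n}"
      "b' \<in> {0..<int n}" "k \<in> {1..<int p}"
      by blast
    have bP: "(b, k) \<in> P" "(b', 0) \<in> P" using uv(3-5) by (auto simp: P_split)
    show "card {e \<in> arcs ?G. tail ?G e = u \<and> head ?G e = v} = n div p"
      unfolding uv(1,2) mult[OF bP] using p0 by (intro card_mult_mod_eq assms(1) arith(1) uv(5)) simp
  next
    fix u v assume "u \<in> ?B" "v \<in> ?B"
    then obtain b k b' k' where uv: "u = \<theta> (b, k)" "v = \<theta> (b', k')" "b \<in> {0..<int n}"
      "b' \<in> {0..<int n}" "k \<in> {1..<int p}" "k' \<in> {1..<int p}"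
      by blast
    have bP: "(b, k) \<in> P" "(b', k') \<in> P" using uv(3-6) by (auto simp: P_split)
    show "card {e \<in> arcs ?G. tail ?G e = u \<and> head ?G e = v} = n div p"
      unfolding uv(1,2) mult[OF bP] using uv(6) by (intro card_mult_mod_eq assms(1) arith(1) uv(5)) simp
  qed
  \<comment> \<open>The division is exact because \<open>p\<close> divides \<open>n\<close>, so the
    natural quotient is the required \<open>d\<close>.\<close>
  moreover have "real (n div p) = real n / real p"
    using arith(1) by (rule real_of_nat_div)
  ultimately show ?thesis by blast
qed

end
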